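(* Let $\theta\in\mathscr{H}$ with $|\theta|_{\mathscr{H}}=1$. Then $$(D_\theta^{*})^{n}1 = H_n\Big[\int_0^1\dot\theta(t)\,dw(t)\Big]\in\mathbf{P},\qquad n=0,1,2,\dots,$$ and hence $e^{D_\theta^{*}}1$ can be defined; in fact $$e^{D_\theta^{*}}1(w)=\exp\Big\{\int_0^1\dot\theta(t)\,dw(t)-\frac12\Big\},\qquad w\in\mathscr{W}.$$ Furthermore, $$E\big[e^{D_\theta}F\big]=E\big[F\cdot e^{D_\theta^{*}}1\big]\qquad\text{for all }F\in\mathbf{P}.$$
   Context: $(\mathscr{W},\mathscr{B}(\mathscr{W}),\gamma)$ is the Wiener space: $\mathscr{W}$ is the set of continuous paths $w:[0,1]\to\mathbb{R}$ with $w(0)=0$, with the $\sigma$-field generated by the topology of uniform convergence, and $\gamma$ is Wiener measure; $E$ is expectation under $\gamma$. $\mathscr{H}\subset\mathscr{W}$ is the Cameron-Martin space of absolutely continuous $h$ with square-integrable derivative $\dot h$, with inner product $\langle h_1,h_2\rangle_{\mathscr{H}}=\int_0^1\dot h_1(t)\dot h_2(t)\,dt$ and norm $|\cdot|_{\mathscr{H}}$. For $h\in\mathscr{H}$, $[h](w):=\int_0^1\dot h(t)\,dw(t)$ (Wiener integral), with the convention $[h](w+\theta)=[h](w)+\langle h,\theta\rangle_{\mathscr{H}}$ for $\theta\in\mathscr{H}$. $\mathbf{P}$ is the algebra of polynomial functionals $F(w)=p([h_1](w),\dots,[h_n](w))$, with $n\in\mathbb{N}$, $h_i\in\mathscr{H}$,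 $p$ a real polynomial in $n$ variables. For $\theta\in\mathscr{H}$, $D_\theta F(w)=\lim_{\varepsilon\to0}\frac1\varepsilon\{F(w+\varepsilon\theta)-F(w)\}$ and $D_\theta^{*}F(w):=-D_\theta F(w)+[\theta](w)F(w)$ for $F\in\mathbf{P}$. The exponentials are $e^{D_\theta}F:=\sum_{n\ge0}\frac1{n!}D_\theta^nF$ for $F\in\mathbf{P}$ (a finite sum), and the formal series $e^{D_\theta^{*}}:=\sum_{n\ge0}\frac1{n!}(D_\theta^{*})^n$. The Hermite polynomials $H_n$ are defined by $\exp(\lambda\xi-\lambda^2/2)=\sum_{n\ge0}\frac{\lambda^n}{n!}H_n[\xi]$, $\lambda\in\mathbb{R}$. *)

theory Defs
  imports
    "HOL-Probability.Probability"
    "HOL-Library.Poly_Mapping"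
    "HOL-Computational_Algebra.Polynomial"
begin

section \<open>Path space and Wiener measure\<close>

text \<open>A path on the unit interval is an extensional function: it is \<^const>\<open>undefined\<close> off
  \<^term>\<open>{0..1::real}\<close>, so that equality of paths is equality on the unit interval.\<close>

type_synonym path = "real \<Rightarrow> real"

definition wiener_paths :: "path set" where
  "wiener_paths = {w \<in> extensional {0..1}. continuous_on {0..1} w \<and> w 0 = 0}"

definition uniform_open :: "path set \<Rightarrow> bool" where
  "uniform_open U \<longleftrightarrow> U \<subseteq> wiener_paths \<and>
     (\<forall>w\<in>U. \<exists>e>0. \<forall>v\<in>wiener_paths. (\<forall>t\<in>{0..1}. \<bar>v t - w t\<bar> < e) \<longrightarrow> v \<in> U)"

definition wiener_borel :: "path measure" where
  "wiener_borel = sigma wiener_paths {U. uniform_open U}"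

text \<open>Wiener measure is the (unique) law of standard Brownian motion: independent increments, the
  increment over \<open>[s, t]\<close> being centred Gaussian with variance \<open>t - s\<close>
  (\<^const>\<open>normal_density\<close> takes the standard deviation).\<close>

definition wiener_measure :: "path measure \<Rightarrow> bool" where
  "wiener_measure \<gamma> \<longleftrightarrow>
     prob_space \<gamma> \<and> space \<gamma> = wiener_paths \<and> sets \<gamma> = sets wiener_borel \<and>
     (\<forall>s t. 0 \<le> s \<and> s < t \<and> t \<le> 1 \<longrightarrow>
        distributed \<gamma> lborel (\<lambda>w. w t - w s) (normal_density 0 (sqrt (t - s)))) \<and>
     (\<forall>n (\<tau> :: nat \<Rightarrow> real). mono_on {..n} \<tau> \<and> \<tau> ` {..n} \<subseteq> {0..1} \<longrightarrow>
        prob_space.indep_vars \<gamma> (\<lambda>_. borel) (\<lambda>i w. w (\<tau> (Suc i)) - w (\<tau> i)) {..<n})"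

section \<open>The Cameron-Martin space\<close>

definition absolutely_continuous_unit :: "path \<Rightarrow> bool" where
  "absolutely_continuous_unit h \<longleftrightarrow>
     (\<forall>\<epsilon>>0. \<exists>\<delta>>0. \<forall>n (a :: nat \<Rightarrow> real) b.
        (\<forall>i<n. 0 \<le> a i \<and> a i \<le> b i \<and> b i \<le> 1) \<and>
        disjoint_family_on (\<lambda>i. {a i<..<b i}) {..<n} \<and>
        (\<Sum>i<n. b i - a i) < \<delta> \<longrightarrow>
        (\<Sum>i<n. \<bar>h (b i) - h (a i)\<bar>) < \<epsilon>)"

text \<open>The derivative of an absolutely continuous path exists almost everywhere; the value 0 is
  only taken on the remaining null set.\<close>

definition path_deriv :: "path \<Rightarrow> real \<Rightarrow> real" where
  "path_deriv h t =
     (if h differentiable (at t within {0..1}) then vector_derivative h (at t within {0..1}) else 0)"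

definition cameron_martin :: "path set" where
  "cameron_martin =
     {h \<in> wiener_paths. absolutely_continuous_unit h \<and>
        set_borel_measurable lborel {0..1} (path_deriv h) \<and>
        set_integrable lborel {0..1} (\<lambda>t. (path_deriv h t)\<^sup>2)}"

definition cm_inner :: "path \<Rightarrow> path \<Rightarrow> real" where
  "cm_inner h\<^sub>1 h\<^sub>2 = (LINT t:{0..1}|lborel. path_deriv h\<^sub>1 t * path_deriv h\<^sub>2 t)"

definition cm_norm :: "path \<Rightarrow> real" where
  "cm_norm h = sqrt (cm_inner h h)"

definition path_add :: "path \<Rightarrow> path \<Rightarrow> path" where
  "path_add v w = (\<lambda>t\<in>{0..1}. v t + w t)"

definition path_scale :: "real \<Rightarrow> path \<Rightarrow> path" where
  "path_scale c w = (\<lambda>t\<in>{0..1}. c * w t)"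

section \<open>The Wiener integral\<close>

text \<open>A list of triples \<open>(c, a, b)\<close> encodes the step function that is the sum of the
  \<open>c\<close>-multiples of the indicators of \<open>(a, b]\<close>.\<close>

definition valid_step :: "(real \<times> real \<times> real) list \<Rightarrow> bool" where
  "valid_step xs \<longleftrightarrow> (\<forall>(c, a, b)\<in>set xs. 0 \<le> a \<and> a \<le> b \<and> b \<le> 1)"

definition step_fun :: "(real \<times> real \<times> real) list \<Rightarrow> real \<Rightarrow> real" where
  "step_fun xs t = (\<Sum>(c, a, b)\<leftarrow>xs. c * indicator {a<..b} t)"

definition step_integral :: "(real \<times> real \<times> real) list \<Rightarrow> path \<Rightarrow> real" where
  "step_integral xs w = (\<Sum>(c, a, b)\<leftarrow>xs. c * (w b - w a))"

text \<open>\<open>X\<close> is a version of the Wiener integral of \<open>f\<close>: the limit in \<open>L\<^sup>2(\<gamma>)\<close> of the integrals of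
  step functions that converge to \<open>f\<close> in \<open>L\<^sup>2[0, 1]\<close>.\<close>

definition is_wiener_integral_of :: "path measure \<Rightarrow> (real \<Rightarrow> real) \<Rightarrow> (path \<Rightarrow> real) \<Rightarrow> bool" where
  "is_wiener_integral_of \<gamma> f X \<longleftrightarrow>
     X \<in> borel_measurable (completion \<gamma>) \<and>
     (\<exists>s :: nat \<Rightarrow> (real \<times> real \<times> real) list.
        (\<forall>n. valid_step (s n)) \<and>
        (\<lambda>n. \<integral>\<^sup>+t\<in>{0..1}. ennreal ((f t - step_fun (s n) t)\<^sup>2) \<partial>lborel) \<longlonglongrightarrow> 0 \<and>
        (\<lambda>n. \<integral>\<^sup>+w. ennreal ((X w - step_integral (s n) w)\<^sup>2) \<partial>completion \<gamma>) \<longlonglongrightarrow> 0)"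

text \<open>A choice \<open>I\<close> of versions \<open>[h] = I h\<close> that obeys the convention
  \<open>[h](w + \<theta>) = [h](w) + \<langle>h, \<theta>\<rangle>\<close> at every path. Such a choice exists: for rapidly converging step
  functions, the paths at which the step integrals converge form a linear subspace of full measure
  that contains the Cameron-Martin space; extend the limit linearly from there to all paths.
  The extension is only measurable for the completed measure. Borel versions would in general not
  do: a Baire category argument shows that a Borel function obeying the convention at every path
  exists only if \<open>h \<mapsto> \<langle>h, \<theta>\<rangle>\<close> is continuous in \<open>\<theta>\<close> for the uniform norm.\<close>

definition wiener_integral :: "path measure \<Rightarrow> (path \<Rightarrow> path \<Rightarrow> real) \<Rightarrow> bool" where
  "wiener_integral \<gamma> I \<longleftrightarrow>
     (\<forall>h\<in>cameron_martin. is_wiener_integral_of \<gamma> (path_deriv h) (I h)) \<and>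
     (\<forall>h\<in>cameron_martin. \<forall>\<theta>\<in>cameron_martin. \<forall>w\<in>wiener_paths.
        I h (path_add w \<theta>) = I h w + cm_inner h \<theta>)"

definition expect :: "path measure \<Rightarrow> (path \<Rightarrow> real) \<Rightarrow> real" where
  "expect \<gamma> F = (\<integral>w. F w \<partial>completion \<gamma>)"

section \<open>Polynomial functionals and the operators\<close>

text \<open>Real polynomials in the variables \<open>x\<^sub>0, x\<^sub>1, \<dots>\<close>: finitely supported maps from monomials
  (finitely supported exponent maps) to coefficients.\<close>

type_synonym mpoly_real = "(nat \<Rightarrow>\<^sub>0 nat) \<Rightarrow>\<^sub>0 real"

definition mpoly_eval :: "mpoly_real \<Rightarrow> (nat \<Rightarrow> real) \<Rightarrow> real" where
  "mpoly_eval p x =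
     (\<Sum>m\<in>Poly_Mapping.keys p. Poly_Mapping.lookup p m *
        (\<Prod>i\<in>Poly_Mapping.keys m. x i ^ Poly_Mapping.lookup m i))"

definition mpoly_in_vars :: "nat \<Rightarrow> mpoly_real \<Rightarrow> bool" where
  "mpoly_in_vars n p \<longleftrightarrow> (\<forall>m\<in>Poly_Mapping.keys p. Poly_Mapping.keys m \<subseteq> {..<n})"

text \<open>Functionals are functions on \<^const>\<open>wiener_paths\<close>; their values elsewhere are irrelevant.\<close>

definition poly_functionals :: "(path \<Rightarrow> path \<Rightarrow> real) \<Rightarrow> (path \<Rightarrow> real) set" where
  "poly_functionals I =
     {F. \<exists>n h p. (\<forall>i<n. h i \<in> cameron_martin) \<and> mpoly_in_vars n p \<and>
           (\<forall>w\<in>wiener_paths. F w = mpoly_eval p (\<lambda>i. I (h i) w))}"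

definition dir_deriv :: "path \<Rightarrow> (path \<Rightarrow> real) \<Rightarrow> path \<Rightarrow> real" where
  "dir_deriv \<theta> F w = Lim (at 0) (\<lambda>\<epsilon>. (F (path_add w (path_scale \<epsilon> \<theta>)) - F w) / \<epsilon>)"

definition dir_deriv_adj ::
  "(path \<Rightarrow> path \<Rightarrow> real) \<Rightarrow> path \<Rightarrow> (path \<Rightarrow> real) \<Rightarrow> path \<Rightarrow> real" where
  "dir_deriv_adj I \<theta> F w = - dir_deriv \<theta> F w + I \<theta> w * F w"

text \<open>The exponential series of an operator, summed pointwise.\<close>

definition exp_term :: "((path \<Rightarrow> real) \<Rightarrow> path \<Rightarrow> real) \<Rightarrow> (path \<Rightarrow> real) \<Rightarrow> path \<Rightarrow> nat \<Rightarrow> real" where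
  "exp_term A F w n = (A ^^ n) F w / fact n"

definition op_exp :: "((path \<Rightarrow> real) \<Rightarrow> path \<Rightarrow> real) \<Rightarrow> (path \<Rightarrow> real) \<Rightarrow> path \<Rightarrow> real" where
  "op_exp A F w = suminf (exp_term A F w)"

definition hermite :: "nat \<Rightarrow> real poly" where
  "hermite = (THE H. \<forall>\<xi> c :: real.
     (\<lambda>n. c ^ n / fact n * poly (H n) \<xi>) sums exp (c * \<xi> - c\<^sup>2 / 2))"

end

theory Submission
  imports Defs "HOL-Complex_Analysis.Complex_Analysis"
begin

text \<open>Along each line \<open>w + \<epsilon>\<theta>\<close> a polynomial functional is a polynomial in \<open>\<epsilon>\<close>, so the exponential of
  \<open>D\<^sub>\<theta>\<close> is Taylor's formula and gives the translation \<open>F(w) \<mapsto> F(w + \<theta>)\<close>. On polynomials in \<open>[\<theta>]\<close> the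
  adjoint acts as \<open>q \<mapsto> x q - q'\<close>, which is the recursion of the Hermite polynomials, and their
  generating function at parameter 1 sums the series for the adjoint. What remains is the Cameron-Martin
  formula for polynomial functionals. For \<open>F = exp L\<close> with \<open>L\<close> an affine function of Wiener integrals,
  both sides are Gaussian moment generating functions, which extend from step functions to all
  integrands by \<open>L\<^sup>2\<close> limits. Differentiating such exponentials in the direction of further affine
  functions \<open>M\<close> brings down a factor \<open>M\<close> at a time, and setting \<open>L = 0\<close> at the end gives the formula for
  all products of Wiener integrals.\<close>

subsection \<open>Hermite polynomials\<close>

text \<open>The obstacle is that \<open>[h]\<close> is fixed at every path by the convention but is
  accessible to integration only as an L^2 limit of step integrals. Translation by \<theta> is not
  known in advance to preserve null sets, so \<open>F(w + \<theta>)\<close> cannot be treated by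
  approximating \<open>F\<close> almost everywhere. The proof therefore never transports the
  measure. It works with affine functions of Wiener integrals whose shift law is known pointwise:
  there translation only changes the constant, and adding \<open>[\<theta>] - 1/2\<close> stays in
  the class. Both sides of the shift formula are then expectations of the same explicit kind. The
  1/2 is half the squared norm of \<theta>. Exponentials rather than monomials carry the argument
  because their expectations depend on the integrand only through its L^2 norm, which survives
  limits. Derivatives are taken only along the sequence \<open>1/(n+1)\<close>: the difference
  quotients of the two sides agree term by term, hence so do their limits.\<close>

lemma powser_sums_zero_imp_coeffs_zero:
  fixes a :: "nat \<Rightarrow> real"
  assumes "\<And>c. (\<lambda>n. a n * c ^ n) sums 0"
  shows "a n = 0"
  using assms
proof (induction n arbitrary: a)
  case 0
  then show ?case using powser_sums_zero_iff[of a 0] by blast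
next
  case (Suc n)
  \<comment> \<open>Termwise differentiation of a series that vanishes everywhere:
    \<open>diffs\<close> moves the coefficient of index \<open>Suc n\<close> to index
    \<open>n\<close>, up to a nonzero factor, so the coefficients are reached one after another by
    evaluation at 0.\<close>
  have "(\<lambda>n. diffs a n * c ^ n) sums 0" for c
    by (rule termdiffs_sums_strong[where f = "\<lambda>_. 0" and K = "\<bar>c\<bar> + 1"])
       (use Suc.prems in auto)
  from Suc.IH[OF this] show ?case by (simp add: diffs_def)
qed

text \<open>\<open>hermite\<close> is a definite description, so facts about it need an explicit
  witness. The recursion is what repeated differentiation of the generating function
  produces.\<close>

fun hermite_rec :: "nat \<Rightarrow> real poly" where
  "hermite_rec 0 = 1"
| "hermite_rec (Suc n) = pCons 0 (hermite_rec n) - pderiv (hermite_rec n)"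

lemma map_poly_complex_of_real_hermite_rec:
  "map_poly complex_of_real (hermite_rec (Suc n)) =
     pCons 0 (map_poly of_real (hermite_rec n)) - pderiv (map_poly of_real (hermite_rec n))"
  by (rule poly_eqI) (auto simp: coeff_map_poly coeff_pCons coeff_pderiv split: nat.splits)

text \<open>Each derivative in \<open>z\<close> brings down \<open>\<xi> - z\<close> from the
  exponent, and the chain rule gives the minus sign of the derivative of the polynomial factor. The
  variable is complex because an entire function equals its Taylor series everywhere; on the real
  line the remainder would have to be estimated.\<close>

lemma higher_deriv_hermite_generating_function:
  fixes \<xi> z :: complex
  shows "(deriv ^^ n) (\<lambda>z. exp (z * \<xi> - z\<^sup>2 / 2)) z =
     poly (map_poly of_real (hermite_rec n)) (\<xi> - z) * exp (z * \<xi> - z\<^sup>2 / 2)"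
proof (induction n arbitrary: z)
  case 0
  then show ?case by simp
next
  case (Suc n)
  let ?p = "map_poly complex_of_real (hermite_rec n)"
  have "(deriv ^^ Suc n) (\<lambda>z. exp (z * \<xi> - z\<^sup>2 / 2)) z =
      deriv (\<lambda>z. poly ?p (\<xi> - z) * exp (z * \<xi> - z\<^sup>2 / 2)) z"
  proof -
    have "(deriv ^^ n) (\<lambda>z. exp (z * \<xi> - z\<^sup>2 / 2)) =
        (\<lambda>z. poly ?p (\<xi> - z) * exp (z * \<xi> - z\<^sup>2 / 2))"
      by (rule ext) (rule Suc.IH)
    then show ?thesis by simp
  qed
  also have "\<dots> = poly (map_poly of_real (hermite_rec (Suc n))) (\<xi> - z) * exp (z * \<xi> - z\<^sup>2 / 2)"
    unfolding map_poly_complex_of_real_hermite_rec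
    by (rule DERIV_imp_deriv)
       (auto intro!: derivative_eq_intros DERIV_chain'[OF _ poly_DERIV] simp: algebra_simps)
  finally show ?case .
qed

lemma poly_map_poly_of_real:
  "poly (map_poly of_real p) (of_real x) = complex_of_real (poly p x)"
  by (induction p) (auto simp: map_poly_pCons)

lemma hermite_rec_sums:
  fixes \<xi> c :: real
  shows "(\<lambda>n. c ^ n / fact n * poly (hermite_rec n) \<xi>) sums exp (c * \<xi> - c\<^sup>2 / 2)"
proof -
  let ?f = "\<lambda>z. exp (z * complex_of_real \<xi> - z\<^sup>2 / 2)"
  have "?f holomorphic_on ball 0 (\<bar>c\<bar> + 1)"
    by (intro holomorphic_intros) auto
  then have "(\<lambda>n. (deriv ^^ n) ?f 0 / fact n * (complex_of_real c - 0) ^ n) sums ?f (of_real c)"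
    by (rule holomorphic_power_series) simp
  moreover have "(deriv ^^ n) ?f 0 / fact n * (complex_of_real c - 0) ^ n =
      of_real (c ^ n / fact n * poly (hermite_rec n) \<xi>)" for n
    by (simp add: higher_deriv_hermite_generating_function poly_map_poly_of_real)
  moreover have "?f (of_real c) = of_real (exp (c * \<xi> - c\<^sup>2 / 2))"
    by (simp add: exp_of_real [symmetric])
  ultimately show ?thesis using sums_of_real_iff by (metis (no_types, lifting) sums_cong)
qed

text \<open>At each fixed \<xi> two candidates give power series in \<open>c\<close> with the same
  sum for every \<open>c\<close>, hence with the same coefficients; a real polynomial is determined
  by its values.\<close>

lemma hermite_eq_hermite_rec: "hermite = hermite_rec"
  unfolding hermite_def
proof (rule the_equality)
  show "\<forall>\<xi> c. (\<lambda>n. c ^ n / fact n * poly (hermite_rec n) \<xi>) sums exp (c * \<xi> - c\<^sup>2 / 2)"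
    using hermite_rec_sums by blast
next
  fix H :: "nat \<Rightarrow> real poly"
  assume H: "\<forall>\<xi> c. (\<lambda>n. c ^ n / fact n * poly (H n) \<xi>) sums exp (c * \<xi> - c\<^sup>2 / 2)"
  have "poly (H n) \<xi> = poly (hermite_rec n) \<xi>" for n \<xi>
  proof -
    have "(poly (H n) \<xi> - poly (hermite_rec n) \<xi>) / fact n = 0"
    proof (rule powser_sums_zero_imp_coeffs_zero
        [where a = "\<lambda>n. (poly (H n) \<xi> - poly (hermite_rec n) \<xi>) / fact n"])
      fix c
      show "(\<lambda>n. (poly (H n) \<xi> - poly (hermite_rec n) \<xi>) / fact n * c ^ n) sums 0"
        using sums_diff[OF H[rule_format, of c \<xi>] hermite_rec_sums[of c \<xi>]]
        by (simp add: field_simps)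
    qed
    then show ?thesis by simp
  qed
  then show "H = hermite_rec"
    by (intro ext) (simp add: poly_eq_poly_eq_iff [symmetric] fun_eq_iff)
qed

subsection \<open>Paths, directional derivatives and polynomials\<close>

text \<open>The equation also holds where \<open>h\<close> is not differentiable. For
  \<open>c \<noteq> 0\<close> the scaled path is not differentiable there either, since scaling back
  would differentiate \<open>h\<close>, and both sides take the default value 0; for
  \<open>c = 0\<close> the scaled path is constant.\<close>

lemma path_deriv_path_scale:
  assumes "t \<in> {0..1}"
  shows "path_deriv (path_scale c h) t = c * path_deriv h t"
proof -
  have nontriv: "at t within {0..1} \<noteq> bot"
    using assms by (simp add: trivial_limit_within islimpt_Icc)
  have scale: "(path_scale d g has_vector_derivative d * D) (at t within {0..1})"
    if "(g has_vector_derivative D) (at t within {0..1})" for d D g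
  proof (rule has_vector_derivative_transform[OF assms])
    show "((\<lambda>s. d * g s) has_vector_derivative d * D) (at t within {0..1})"
      using that by (rule has_vector_derivative_mult_right)
  qed (simp add: path_scale_def)
  show ?thesis
  proof (cases "h differentiable (at t within {0..1})")
    case True
    then have "(h has_vector_derivative path_deriv h t) (at t within {0..1})"
      by (simp add: path_deriv_def vector_derivative_works)
    from scale[OF this] show ?thesis
      using vector_derivative_within[OF nontriv] differentiableI_vector
      by (metis path_deriv_def)
  next
    case False
    have "\<not> path_scale c h differentiable (at t within {0..1})" if "c \<noteq> 0"
    proof
      assume "path_scale c h differentiable (at t within {0..1})"
      then obtain D where "(path_scale c h has_vector_derivative D) (at t within {0..1})"
        using vector_derivative_works by blast
      from scale[OF this, of "inverse c"] have "(h has_vector_derivative inverse c * D) (at t within {0..1})"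
        by (rule has_vector_derivative_transform[OF assms, rotated])
           (use that in \<open>simp add: path_scale_def\<close>)
      then show False using False differentiableI_vector by blast
    qed
    moreover have "path_deriv (path_scale 0 h) t = 0"
      using vector_derivative_within[OF nontriv, of "path_scale 0 h" 0]
        has_vector_derivative_transform[OF assms _ has_vector_derivative_const, of "path_scale 0 h" 0]
      by (auto simp: path_deriv_def path_scale_def)
    ultimately show ?thesis
      using False by (cases "c = 0") (auto simp: path_deriv_def)
  qed
qed

lemma path_add_wiener_paths:
  assumes "v \<in> wiener_paths" "w \<in> wiener_paths"
  shows "path_add v w \<in> wiener_paths"
proof -
  have "continuous_on {0..1} (path_add v w) \<longleftrightarrow> continuous_on {0..1} (\<lambda>t. v t + w t)"
    by (rule continuous_on_cong) (auto simp: path_add_def)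
  then show ?thesis
    using assms by (auto simp: wiener_paths_def path_add_def intro: continuous_intros)
qed

lemma path_scale_wiener_paths:
  assumes "w \<in> wiener_paths"
  shows "path_scale c w \<in> wiener_paths"
proof -
  have "continuous_on {0..1} (path_scale c w) \<longleftrightarrow> continuous_on {0..1} (\<lambda>t. c * w t)"
    by (rule continuous_on_cong) (auto simp: path_scale_def)
  then show ?thesis
    using assms by (auto simp: wiener_paths_def path_scale_def intro: continuous_intros)
qed

lemma path_add_path_scale_0:
  assumes "w \<in> wiener_paths"
  shows "path_add w (path_scale 0 h) = w"
  using assms by (auto simp: path_add_def path_scale_def wiener_paths_def extensional_def)

lemma path_scale_1:
  assumes "w \<in> wiener_paths"
  shows "path_scale 1 w = w"
  using assms by (auto simp: path_scale_def wiener_paths_def extensional_def)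

lemma path_add_path_scale:
  "path_add (path_add w (path_scale c h)) (path_scale d h) = path_add w (path_scale (c + d) h)"
  by (auto simp: path_add_def path_scale_def algebra_simps)

lemma absolutely_continuous_unit_path_scale:
  assumes "absolutely_continuous_unit h"
  shows "absolutely_continuous_unit (path_scale c h)"
  unfolding absolutely_continuous_unit_def
proof (intro allI impI)
  fix \<epsilon> :: real assume "\<epsilon> > 0"
  \<comment> \<open>Adding 1 to the denominator covers \<open>c = 0\<close> and makes the final
    inequality strict.\<close>
  define \<epsilon>' where "\<epsilon>' = \<epsilon> / (\<bar>c\<bar> + 1)"
  have "\<epsilon>' > 0" using \<open>\<epsilon> > 0\<close> by (simp add: \<epsilon>'_def add_nonneg_pos)
  from assms[unfolded absolutely_continuous_unit_def, THEN spec, THEN mp, OF this]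
  obtain \<delta> where "\<delta> > 0" and \<delta>: "\<forall>n (a :: nat \<Rightarrow> real) b.
      (\<forall>i<n. 0 \<le> a i \<and> a i \<le> b i \<and> b i \<le> 1) \<and>
      disjoint_family_on (\<lambda>i. {a i<..<b i}) {..<n} \<and> (\<Sum>i<n. b i - a i) < \<delta> \<longrightarrow>
      (\<Sum>i<n. \<bar>h (b i) - h (a i)\<bar>) < \<epsilon>'"
    by (elim exE conjE) (rule that)
  show "\<exists>\<delta>>0. \<forall>n (a :: nat \<Rightarrow> real) b.
      (\<forall>i<n. 0 \<le> a i \<and> a i \<le> b i \<and> b i \<le> 1) \<and>
      disjoint_family_on (\<lambda>i. {a i<..<b i}) {..<n} \<and> (\<Sum>i<n. b i - a i) < \<delta> \<longrightarrow>
      (\<Sum>i<n. \<bar>path_scale c h (b i) - path_scale c h (a i)\<bar>) < \<epsilon>"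
  proof (intro exI[of _ \<delta>] conjI allI impI \<open>\<delta> > 0\<close>)
    fix n and a b :: "nat \<Rightarrow> real"
    assume *: "(\<forall>i<n. 0 \<le> a i \<and> a i \<le> b i \<and> b i \<le> 1) \<and>
      disjoint_family_on (\<lambda>i. {a i<..<b i}) {..<n} \<and> (\<Sum>i<n. b i - a i) < \<delta>"
    have "(\<Sum>i<n. \<bar>path_scale c h (b i) - path_scale c h (a i)\<bar>) =
        (\<Sum>i<n. \<bar>c\<bar> * \<bar>h (b i) - h (a i)\<bar>)"
    proof (rule sum.cong)
      fix i assume "i \<in> {..<n}"
      then have "a i \<in> {0..1}" "b i \<in> {0..1}" using * by fastforce+
      then show "\<bar>path_scale c h (b i) - path_scale c h (a i)\<bar> = \<bar>c\<bar> * \<bar>h (b i) - h (a i)\<bar>"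
        by (simp add: path_scale_def abs_mult [symmetric] right_diff_distrib)
    qed simp
    also have "\<dots> = \<bar>c\<bar> * (\<Sum>i<n. \<bar>h (b i) - h (a i)\<bar>)" by (simp add: sum_distrib_left)
    also have "\<dots> \<le> \<bar>c\<bar> * \<epsilon>'" using \<delta>[rule_format, OF *] by (intro mult_left_mono) auto
    also have "\<dots> < \<epsilon>" using \<open>\<epsilon> > 0\<close> by (simp add: \<epsilon>'_def field_simps)
    finally show "(\<Sum>i<n. \<bar>path_scale c h (b i) - path_scale c h (a i)\<bar>) < \<epsilon>" .
  qed
qed

lemma path_scale_cameron_martin:
  assumes "h \<in> cameron_martin"
  shows "path_scale c h \<in> cameron_martin"
proof -
  have h: "h \<in> wiener_paths" "absolutely_continuous_unit h"
    "set_borel_measurable lborel {0..1} (path_deriv h)"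
    "set_integrable lborel {0..1} (\<lambda>t. (path_deriv h t)\<^sup>2)"
    using assms by (auto simp: cameron_martin_def)
  have "(\<lambda>t. indicator {0..1} t *\<^sub>R path_deriv (path_scale c h) t) =
      (\<lambda>t. c * (indicator {0..1} t *\<^sub>R path_deriv h t))"
    by (auto simp: path_deriv_path_scale indicator_def)
  then have "set_borel_measurable lborel {0..1} (path_deriv (path_scale c h))"
    using h(3) by (auto simp: set_borel_measurable_def)
  moreover have "(\<lambda>t. indicator {0..1} t *\<^sub>R (path_deriv (path_scale c h) t)\<^sup>2) =
      (\<lambda>t. c\<^sup>2 * (indicator {0..1} t *\<^sub>R (path_deriv h t)\<^sup>2))"
    by (auto simp: path_deriv_path_scale indicator_def power_mult_distrib)
  then have "set_integrable lborel {0..1} (\<lambda>t. (path_deriv (path_scale c h) t)\<^sup>2)"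
    using h(4) by (auto simp: set_integrable_def)
  ultimately show ?thesis
    using h path_scale_wiener_paths absolutely_continuous_unit_path_scale
    by (auto simp: cameron_martin_def)
qed

lemma cm_inner_path_scale: "cm_inner g (path_scale c h) = c * cm_inner g h"
proof -
  have "cm_inner g (path_scale c h) = (LINT t:{0..1}|lborel. c * (path_deriv g t * path_deriv h t))"
    unfolding cm_inner_def by (rule set_lebesgue_integral_cong) (auto simp: path_deriv_path_scale)
  then show ?thesis by (simp add: cm_inner_def)
qed

section \<open>Directional derivatives of functionals that are polynomial along a line\<close>

lemma dir_deriv_poly:
  assumes "\<And>\<epsilon>. F (path_add w (path_scale \<epsilon> \<theta>)) = poly q \<epsilon>"
  shows "dir_deriv \<theta> F (path_add w (path_scale \<epsilon> \<theta>)) = poly (pderiv q) \<epsilon>"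
proof -
  have "(\<lambda>\<delta>. (poly q (\<epsilon> + \<delta>) - poly q \<epsilon>) / \<delta>) \<midarrow>0\<rightarrow> poly (pderiv q) \<epsilon>"
    using poly_DERIV[of q \<epsilon>] by (simp add: DERIV_def)
  then show ?thesis
    unfolding dir_deriv_def path_add_path_scale assms by (rule tendsto_Lim[rotated]) simp
qed

text \<open>The iteration works because \<open>dir_deriv_poly\<close> gives the derivative at every
  point of the line and not only at \<open>w\<close>: the derived functional is again a polynomial
  along the same line.\<close>

lemma higher_dir_deriv_poly:
  assumes "\<And>\<epsilon>. F (path_add w (path_scale \<epsilon> \<theta>)) = poly q \<epsilon>"
  shows "(dir_deriv \<theta> ^^ n) F (path_add w (path_scale \<epsilon> \<theta>)) = poly ((pderiv ^^ n) q) \<epsilon>"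
proof (induction n arbitrary: \<epsilon>)
  case (Suc n)
  show ?case using dir_deriv_poly[OF Suc.IH] by simp
qed (simp add: assms)

lemma op_exp_dir_deriv_poly:
  assumes q: "\<And>\<epsilon>. F (path_add w (path_scale \<epsilon> \<theta>)) = poly q \<epsilon>"
    and "w \<in> wiener_paths" "\<theta> \<in> wiener_paths"
  shows "op_exp (dir_deriv \<theta>) F w = F (path_add w \<theta>)"
proof -
  \<comment> \<open>The factorial cancels against the n-th derivative at 0, so the exponential
    series is the finite sum of the coefficients of \<open>q\<close>, that is, its value at
    1.\<close>
  have "exp_term (dir_deriv \<theta>) F w n = coeff q n" for n
  proof -
    have "(dir_deriv \<theta> ^^ n) F w = poly ((pderiv ^^ n) q) 0"
      using higher_dir_deriv_poly[OF q, of n 0] path_add_path_scale_0[OF assms(2)] by simp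
    then show ?thesis
      by (simp add: exp_term_def poly_0_coeff_0 coeff_higher_pderiv pochhammer_fact [symmetric])
  qed
  then have "op_exp (dir_deriv \<theta>) F w = suminf (coeff q)"
    unfolding op_exp_def by (intro arg_cong[where f = suminf] ext)
  also have "\<dots> = (\<Sum>n\<le>degree q. coeff q n)"
    by (rule suminf_finite) (auto simp: coeff_eq_0)
  also have "\<dots> = poly q 1" by (simp add: poly_altdef)
  also have "\<dots> = F (path_add w \<theta>)" using q[of 1] path_scale_1[OF assms(3)] by simp
  finally show ?thesis .
qed

section \<open>Evaluation of polynomials in several variables\<close>

lemma mpoly_eval_line:
  obtains q where "\<And>\<epsilon>. poly q \<epsilon> = mpoly_eval p (\<lambda>i. x i + \<epsilon> * a i)"
proof
  show "poly (\<Sum>m\<in>Poly_Mapping.keys p. smult (Poly_Mapping.lookup p m)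
      (\<Prod>i\<in>Poly_Mapping.keys m. [:x i, a i:] ^ Poly_Mapping.lookup m i)) \<epsilon> =
      mpoly_eval p (\<lambda>i. x i + \<epsilon> * a i)" for \<epsilon>
    by (simp add: mpoly_eval_def poly_sum poly_prod)
qed

lemma mpoly_eval_cong:
  assumes "mpoly_in_vars n p" "\<And>i. i < n \<Longrightarrow> x i = y i"
  shows "mpoly_eval p x = mpoly_eval p y"
proof -
  have "(\<Prod>i\<in>Poly_Mapping.keys m. x i ^ Poly_Mapping.lookup m i) =
      (\<Prod>i\<in>Poly_Mapping.keys m. y i ^ Poly_Mapping.lookup m i)"
    if "m \<in> Poly_Mapping.keys p" for m
  proof (rule prod.cong)
    fix i assume "i \<in> Poly_Mapping.keys m"
    then have "i < n" using assms(1) that by (auto simp: mpoly_in_vars_def)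
    then show "x i ^ Poly_Mapping.lookup m i = y i ^ Poly_Mapping.lookup m i"
      by (simp add: assms(2))
  qed simp
  then show ?thesis by (simp add: mpoly_eval_def)
qed

text \<open>Serves to exhibit \<open>H_n([\<theta>])\<close> as a polynomial functional of the
  single variable of index 0.\<close>

lemma univariate_mpoly:
  obtains p where "mpoly_in_vars 1 p" "\<And>x. mpoly_eval p x = poly q (x 0)"
proof -
  define mon :: "nat \<Rightarrow> nat \<Rightarrow>\<^sub>0 nat" where "mon = Poly_Mapping.single 0"
  define c where "c m = (if Poly_Mapping.keys m \<subseteq> {0} then coeff q (Poly_Mapping.lookup m 0) else 0)"
    for m :: "nat \<Rightarrow>\<^sub>0 nat"
  define K where "K = {k. coeff q k \<noteq> 0}"
  have mon: "mon (Poly_Mapping.lookup m 0) = m" if "Poly_Mapping.keys m \<subseteq> {0}" for m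
    using that unfolding mon_def
    by (intro poly_mapping_eqI) (auto simp: lookup_single when_def in_keys_iff)
  have lookup_mon: "Poly_Mapping.lookup (mon k) 0 = k" for k
    by (simp add: mon_def)
  have inj: "inj mon" by (metis injI lookup_mon)
  have keys_mon: "Poly_Mapping.keys (mon k) \<subseteq> {0}" for k
    by (simp add: mon_def)
  have fin: "finite K"
    unfolding K_def by (rule finite_subset[of _ "{..degree q}"]) (auto intro: le_degree)
  have c: "{m. c m \<noteq> 0} = mon ` K"
  proof (intro equalityI subsetI)
    fix m assume "m \<in> {m. c m \<noteq> 0}"
    then have "Poly_Mapping.keys m \<subseteq> {0}" "Poly_Mapping.lookup m 0 \<in> K"
      by (auto simp: c_def K_def split: if_splits)
    then show "m \<in> mon ` K" using mon by (metis image_eqI)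
  qed (use keys_mon in \<open>auto simp: c_def K_def lookup_mon\<close>)
  define p where "p = Abs_poly_mapping c"
  have lookup_p: "Poly_Mapping.lookup p = c"
    unfolding p_def by (rule lookup_Abs_poly_mapping) (simp add: c fin)
  then have keys_p: "Poly_Mapping.keys p = mon ` K"
    by (simp add: keys_def c)
  show thesis
  proof
    show "mpoly_in_vars 1 p"
      using keys_mon by (fastforce simp: mpoly_in_vars_def keys_p)
    fix x :: "nat \<Rightarrow> real"
    have "mpoly_eval p x = (\<Sum>k\<in>K. c (mon k) *
        (\<Prod>i\<in>Poly_Mapping.keys (mon k). x i ^ Poly_Mapping.lookup (mon k) i))"
      unfolding mpoly_eval_def lookup_p keys_p
      using inj by (subst sum.reindex) (auto intro: inj_on_subset)
    also have "\<dots> = (\<Sum>k\<in>K. coeff q k * x 0 ^ k)"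
    proof (rule sum.cong)
      fix k
      \<comment> \<open>For \<open>k = 0\<close> the monomial has no keys, and the empty product is
        the required value 1.\<close>
      have "(\<Prod>i\<in>Poly_Mapping.keys (mon k). x i ^ Poly_Mapping.lookup (mon k) i) = x 0 ^ k"
        by (cases "k = 0") (auto simp: mon_def)
      then show "c (mon k) * (\<Prod>i\<in>Poly_Mapping.keys (mon k). x i ^ Poly_Mapping.lookup (mon k) i) =
          coeff q k * x 0 ^ k"
        using keys_mon by (simp add: c_def lookup_mon)
    qed simp
    also have "\<dots> = (\<Sum>k\<le>degree q. coeff q k * x 0 ^ k)"
      unfolding K_def by (rule sum.mono_neutral_left) (auto intro: le_degree)
    also have "\<dots> = poly q (x 0)" by (simp add: poly_altdef)
    finally show "mpoly_eval p x = poly q (x 0)" .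
  qed
qed

subsection \<open>Integrals of squares\<close>

lemma integrable_square_mult:
  fixes f g :: "'a \<Rightarrow> real"
  assumes [measurable]: "f \<in> borel_measurable M" "g \<in> borel_measurable M"
    and "integrable M (\<lambda>x. (f x)\<^sup>2)" "integrable M (\<lambda>x. (g x)\<^sup>2)"
  shows "integrable M (\<lambda>x. f x * g x)"
proof (rule Bochner_Integration.integrable_bound)
  show "integrable M (\<lambda>x. (f x)\<^sup>2 + (g x)\<^sup>2)" using assms by simp
  have "\<bar>a * b\<bar> \<le> \<bar>a\<^sup>2 + b\<^sup>2\<bar>" for a b :: real
  proof -
    have "2 * \<bar>a * b\<bar> \<le> a\<^sup>2 + b\<^sup>2"
      using sum_squares_bound[of "\<bar>a\<bar>" "\<bar>b\<bar>"] by (simp add: abs_mult)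
    then show ?thesis by linarith
  qed
  then show "AE x in M. norm (f x * g x) \<le> norm ((f x)\<^sup>2 + (g x)\<^sup>2)" by simp
qed simp

lemma integrable_square_lincomb:
  fixes f g :: "'a \<Rightarrow> real"
  assumes [measurable]: "f \<in> borel_measurable M" "g \<in> borel_measurable M"
    and "integrable M (\<lambda>x. (f x)\<^sup>2)" "integrable M (\<lambda>x. (g x)\<^sup>2)"
  shows "integrable M (\<lambda>x. (c * f x + d * g x)\<^sup>2)"
    and "(\<integral>x. (c * f x + d * g x)\<^sup>2 \<partial>M) =
      c\<^sup>2 * (\<integral>x. (f x)\<^sup>2 \<partial>M) + 2 * c * d * (\<integral>x. f x * g x \<partial>M) + d\<^sup>2 * (\<integral>x. (g x)\<^sup>2 \<partial>M)"
proof -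
  have *: "(c * f x + d * g x)\<^sup>2 = c\<^sup>2 * (f x)\<^sup>2 + 2 * c * d * (f x * g x) + d\<^sup>2 * (g x)\<^sup>2" for x
    by (simp add: power2_eq_square algebra_simps)
  show "integrable M (\<lambda>x. (c * f x + d * g x)\<^sup>2)"
    unfolding * using assms integrable_square_mult[OF assms] by simp
  show "(\<integral>x. (c * f x + d * g x)\<^sup>2 \<partial>M) =
      c\<^sup>2 * (\<integral>x. (f x)\<^sup>2 \<partial>M) + 2 * c * d * (\<integral>x. f x * g x \<partial>M) + d\<^sup>2 * (\<integral>x. (g x)\<^sup>2 \<partial>M)"
    unfolding * using assms integrable_square_mult[OF assms] by simp
qed

text \<open>The integral of \<open>(c f + d g)^2\<close> is a nonnegative quadratic form in
  \<open>c\<close> and \<open>d\<close>; suitable choices of the two give the bound.\<close>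

lemma integral_Cauchy_Schwarz:
  fixes f g :: "'a \<Rightarrow> real"
  assumes "f \<in> borel_measurable M" "g \<in> borel_measurable M"
    and "integrable M (\<lambda>x. (f x)\<^sup>2)" "integrable M (\<lambda>x. (g x)\<^sup>2)"
  shows "\<bar>\<integral>x. f x * g x \<partial>M\<bar> \<le> sqrt ((\<integral>x. (f x)\<^sup>2 \<partial>M) * (\<integral>x. (g x)\<^sup>2 \<partial>M))"
proof -
  define A B C where "A = (\<integral>x. (f x)\<^sup>2 \<partial>M)" and "B = (\<integral>x. (g x)\<^sup>2 \<partial>M)"
    and "C = (\<integral>x. f x * g x \<partial>M)"
  have quad: "0 \<le> c\<^sup>2 * A + 2 * c * d * C + d\<^sup>2 * B" for c d
    using Bochner_Integration.integral_nonneg[of M "\<lambda>x. (c * f x + d * g x)\<^sup>2"]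
      integrable_square_lincomb(2)[OF assms, of c d] by (simp add: A_def B_def C_def)
  have "A \<ge> 0" using quad[of 1 0] by simp
  have "C\<^sup>2 \<le> A * B"
  proof (cases "A = 0")
    case True
    have "C = 0"
    proof (rule ccontr)
      assume "C \<noteq> 0"
      \<comment> \<open>With \<open>A = 0\<close> the form is linear in \<open>c\<close>; this
        \<open>c\<close> gives it the value -1.\<close>
      then show False
        using quad[of "- (B + 1) / (2 * C)" 1] True by (simp add: field_simps)
    qed
    then show ?thesis using True by simp
  next
    case False
    \<comment> \<open>The choice \<open>c = C\<close>, \<open>d = - A\<close> minimises the form up
      to scaling and leaves the discriminant times \<open>A\<close>.\<close>
    then have "0 \<le> A * (A * B - C\<^sup>2)"
      using quad[of C "- A"] by (simp add: power2_eq_square algebra_simps)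
    then show ?thesis using False \<open>A \<ge> 0\<close> by (simp add: zero_le_mult_iff)
  qed
  then have "\<bar>C\<bar> \<le> sqrt (A * B)" using real_le_rsqrt by (metis power2_abs)
  then show ?thesis by (simp add: A_def B_def C_def)
qed

text \<open>L^2 convergence is expressed throughout by integrals of squares instead of norms, so the
  triangle inequality is replaced by expanding the square and bounding the cross term by
  Cauchy-Schwarz.\<close>

lemma integral_square_tendsto_zero_lincomb:
  fixes f g :: "nat \<Rightarrow> 'a \<Rightarrow> real"
  assumes "\<And>n. f n \<in> borel_measurable M" "\<And>n. g n \<in> borel_measurable M"
    and "\<And>n. integrable M (\<lambda>x. (f n x)\<^sup>2)" "\<And>n. integrable M (\<lambda>x. (g n x)\<^sup>2)"
    and f: "(\<lambda>n. \<integral>x. (f n x)\<^sup>2 \<partial>M) \<longlonglongrightarrow> 0" and g: "(\<lambda>n. \<integral>x. (g n x)\<^sup>2 \<partial>M) \<longlonglongrightarrow> 0"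
  shows "(\<lambda>n. \<integral>x. (c * f n x + d * g n x)\<^sup>2 \<partial>M) \<longlonglongrightarrow> 0"
proof -
  have "(\<lambda>n. sqrt ((\<integral>x. (f n x)\<^sup>2 \<partial>M) * (\<integral>x. (g n x)\<^sup>2 \<partial>M))) \<longlonglongrightarrow> sqrt (0 * 0)"
    using f g by (intro tendsto_intros)
  then have bound: "(\<lambda>n. sqrt ((\<integral>x. (f n x)\<^sup>2 \<partial>M) * (\<integral>x. (g n x)\<^sup>2 \<partial>M))) \<longlonglongrightarrow> 0"
    by simp
  have "(\<lambda>n. \<integral>x. f n x * g n x \<partial>M) \<longlonglongrightarrow> 0"
  proof (rule Lim_null_comparison[OF always_eventually bound], rule allI)
    fix n
    show "norm (\<integral>x. f n x * g n x \<partial>M) \<le>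
        sqrt ((\<integral>x. (f n x)\<^sup>2 \<partial>M) * (\<integral>x. (g n x)\<^sup>2 \<partial>M))"
      unfolding real_norm_def by (rule integral_Cauchy_Schwarz) (rule assms)+
  qed
  then have "(\<lambda>n. c\<^sup>2 * (\<integral>x. (f n x)\<^sup>2 \<partial>M) + 2 * c * d * (\<integral>x. f n x * g n x \<partial>M) +
      d\<^sup>2 * (\<integral>x. (g n x)\<^sup>2 \<partial>M)) \<longlonglongrightarrow> c\<^sup>2 * 0 + 2 * c * d * 0 + d\<^sup>2 * 0"
    using f g by (intro tendsto_intros)
  then show ?thesis 
    unfolding integrable_square_lincomb(2)[OF assms(1) assms(2) assms(3) assms(4)] by simp
qed

subsection \<open>Step functions\<close>

lemma step_fun_simps [simp]:
  "step_fun [] t = 0"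
  "step_fun ((c, a, b) # xs) t = c * indicator {a<..b} t + step_fun xs t"
  "step_fun (xs @ ys) t = step_fun xs t + step_fun ys t"
  by (auto simp: step_fun_def)

lemma step_integral_simps [simp]:
  "step_integral [] w = 0"
  "step_integral ((c, a, b) # xs) w = c * (w b - w a) + step_integral xs w"
  "step_integral (xs @ ys) w = step_integral xs w + step_integral ys w"
  by (auto simp: step_integral_def)

lemma valid_step_simps [simp]:
  "valid_step []"
  "valid_step ((c, a, b) # xs) \<longleftrightarrow> 0 \<le> a \<and> a \<le> b \<and> b \<le> 1 \<and> valid_step xs"
  "valid_step (xs @ ys) \<longleftrightarrow> valid_step xs \<and> valid_step ys"
  by (simp_all add: valid_step_def ball_Un)

text \<open>Linear combinations are formed on the lists, by scaling and concatenation, so that step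
  function and step integral change together.\<close>

definition step_scale :: "real \<Rightarrow> (real \<times> real \<times> real) list \<Rightarrow> (real \<times> real \<times> real) list" where
  "step_scale d = map (\<lambda>(c, a, b). (d * c, a, b))"

lemma step_scale [simp]:
  "step_fun (step_scale d xs) t = d * step_fun xs t"
  "step_integral (step_scale d xs) w = d * step_integral xs w"
  "valid_step (step_scale d xs) \<longleftrightarrow> valid_step xs"
  by (induction xs) (auto simp: step_scale_def algebra_simps)

lemma step_fun_outside:
  assumes "valid_step xs" "t \<notin> {0..1}"
  shows "step_fun xs t = 0"
  using assms by (induction xs) (auto simp: indicator_def)

lemma borel_measurable_step_fun [measurable]: "step_fun xs \<in> borel_measurable borel"
proof (induction xs)
  case (Cons x xs)
  then show ?case by (cases x) (simp add: fun_eq_iff)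
qed simp

text \<open>The step function is the step integral of the path that jumps from 0 to 1 at \<open>t\<close>.\<close>

lemma step_fun_eq_step_integral:
  assumes "valid_step xs"
  shows "step_fun xs t = step_integral xs (indicator {t..})"
  using assms by (induction xs) (auto simp: indicator_def)

text \<open>The indicator keeps exactly the cells inside the interval, and their increments
  telescope. Membership is tested at the right endpoint of a cell because the intervals are open on
  the left and closed on the right.\<close>

lemma sum_increments_eq:
  fixes \<tau> :: "nat \<Rightarrow> real"
  assumes \<tau>: "strict_mono_on {..n} \<tau>" and jk: "j \<le> k" "k \<le> n"
  shows "(\<Sum>i<n. indicator {\<tau> j<..\<tau> k} (\<tau> (Suc i)) * (w (\<tau> (Suc i)) - w (\<tau> i))) =
    w (\<tau> k) - (w (\<tau> j) :: real)"
proof -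
  have less: "\<tau> i < \<tau> i' \<longleftrightarrow> i < i'" if "i \<le> n" "i' \<le> n" for i i'
    using \<tau> that by (simp add: strict_mono_on_less)
  have le: "\<tau> i \<le> \<tau> i' \<longleftrightarrow> i \<le> i'" if "i \<le> n" "i' \<le> n" for i i'
    using less[OF that(2) that(1)] by (simp add: not_less [symmetric])
  have "(\<Sum>i<n. indicator {\<tau> j<..\<tau> k} (\<tau> (Suc i)) * (w (\<tau> (Suc i)) - w (\<tau> i))) =
      (\<Sum>i\<in>{j..<k}. w (\<tau> (Suc i)) - w (\<tau> i))"
  proof (rule sum.mono_neutral_cong_right)
    show "{j..<k} \<subseteq> {..<n}" using jk by auto
  qed (use jk in \<open>auto simp: indicator_def less le\<close>)
  also have "\<dots> = w (\<tau> k) - w (\<tau> j)"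
    using jk by (intro sum_Suc_diff') simp
  finally show ?thesis .
qed

text \<open>The intervals of a list may overlap, while independence is available for increments over
  successive cells; hence the refinement to a common partition. The identity is claimed for every
  function \<open>w\<close>, not only for continuous paths, so that jump paths can be inserted
  later.\<close>

lemma step_integral_partition:
  assumes "valid_step xs"
  obtains n and \<tau> :: "nat \<Rightarrow> real" where "strict_mono_on {..n} \<tau>" "\<tau> ` {..n} \<subseteq> {0..1}"
    "\<And>w. step_integral xs w = (\<Sum>i<n. step_fun xs (\<tau> (Suc i)) * (w (\<tau> (Suc i)) - w (\<tau> i)))"
proof -
  \<comment> \<open>The point 0 keeps the set of partition points nonempty when \<open>xs\<close> is
    empty; then \<open>n = 0\<close> and the sum is empty.\<close>
  define A where "A = insert 0 ((\<lambda>(c, a, b). a) ` set xs \<union> (\<lambda>(c, a, b). b) ` set xs)"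
  define l where "l = sorted_list_of_set A"
  have A: "finite A" "A \<subseteq> {0..1}"
    using assms by (auto simp: A_def valid_step_def)
  have set_l: "set l = A" and sorted: "sorted_wrt (<) l"
    using A by (simp_all add: l_def)
  have "l \<noteq> []" using set_l by (auto simp: A_def)
  define n where "n = length l - 1"
  have len: "length l = Suc n" using \<open>l \<noteq> []\<close> by (simp add: n_def)
  define \<tau> where "\<tau> i = l ! i" for i
  have \<tau>: "strict_mono_on {..n} \<tau>"
    by (rule strict_mono_onI) (use sorted len in \<open>auto simp: \<tau>_def sorted_wrt_iff_nth_less\<close>)
  have range: "\<tau> ` {..n} \<subseteq> {0..1}"
    using A set_l len nth_mem[of _ l] unfolding \<tau>_def by (auto simp: less_Suc_eq_le)
  have index: "\<exists>i\<le>n. x = \<tau> i" if "x \<in> A" for x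
    using that set_l len by (auto simp: \<tau>_def in_set_conv_nth less_Suc_eq_le)
  have incr: "w b - w a = (\<Sum>i<n. indicator {a<..b} (\<tau> (Suc i)) * (w (\<tau> (Suc i)) - w (\<tau> i)))"
    if abc: "(c, a, b) \<in> set xs" for c a b and w :: "real \<Rightarrow> real"
  proof -
    have "a \<in> A" "b \<in> A" using abc by (force simp: A_def)+
    then obtain j k where jk: "j \<le> n" "a = \<tau> j" "k \<le> n" "b = \<tau> k"
      using index by metis
    have "a \<le> b" using abc assms by (auto simp: valid_step_def)
    then have "j \<le> k" using jk \<tau> by (simp add: strict_mono_on_less_eq)
    then show ?thesis using sum_increments_eq[OF \<tau>] jk by simp
  qed
  \<comment> \<open>The partition stays the one made for \<open>xs\<close>, so the induction runs
    over lists with entries from \<open>xs\<close>.\<close>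
  have "step_integral ys w = (\<Sum>i<n. step_fun ys (\<tau> (Suc i)) * (w (\<tau> (Suc i)) - w (\<tau> i)))"
    if "set ys \<subseteq> set xs" for w ys
    using that
  proof (induction ys)
    case (Cons y ys)
    obtain c a b where y: "y = (c, a, b)" by (cases y)
    have "step_integral (y # ys) w = c * (w b - w a) + step_integral ys w"
      by (simp add: y)
    also have "\<dots> = (\<Sum>i<n. c * (indicator {a<..b} (\<tau> (Suc i)) * (w (\<tau> (Suc i)) - w (\<tau> i))) +
        step_fun ys (\<tau> (Suc i)) * (w (\<tau> (Suc i)) - w (\<tau> i)))"
    proof -
      have "(c, a, b) \<in> set xs" "set ys \<subseteq> set xs" using Cons.prems by (auto simp: y)
      then show ?thesis
        by (simp only: incr[of c a b w] Cons.IH sum.distrib sum_distrib_left)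
    qed
    finally show ?case by (simp add: y algebra_simps)
  qed simp
  then show thesis using that[OF \<tau> range] by blast
qed

section \<open>Gaussian law of step integrals\<close>

lemma normal_density_mgf:
  assumes "\<sigma> > 0"
  shows "integrable lborel (\<lambda>x. normal_density 0 \<sigma> x * exp (d * x))"
    and "(\<integral>x. normal_density 0 \<sigma> x * exp (d * x) \<partial>lborel) = exp (d\<^sup>2 * \<sigma>\<^sup>2 / 2)"
proof -
  have *: "normal_density 0 \<sigma> x * exp (d * x) = exp (d\<^sup>2 * \<sigma>\<^sup>2 / 2) * normal_density (d * \<sigma>\<^sup>2) \<sigma> x" for x
  proof -
    \<comment> \<open>Completing the square: the exponential factor turns the density into a
      constant times the normal density with mean \<open>d * \<sigma>^2\<close> and the same
      variance.\<close>
    have "- x\<^sup>2 / (2 * \<sigma>\<^sup>2) + d * x = d\<^sup>2 * \<sigma>\<^sup>2 / 2 + - (x - d * \<sigma>\<^sup>2)\<^sup>2 / (2 * \<sigma>\<^sup>2)"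
      using assms by (simp add: field_simps power2_eq_square)
    then show ?thesis by (simp add: normal_density_def exp_add [symmetric])
  qed
  show "integrable lborel (\<lambda>x. normal_density 0 \<sigma> x * exp (d * x))"
    unfolding * using assms by simp
  show "(\<integral>x. normal_density 0 \<sigma> x * exp (d * x) \<partial>lborel) = exp (d\<^sup>2 * \<sigma>\<^sup>2 / 2)"
    unfolding * using assms by simp
qed

text \<open>The partition identity at jump paths rewrites the step function as a combination of
  indicators of disjoint cells, so its square has no cross terms.\<close>

lemma integral_step_fun_square:
  assumes "valid_step xs" and \<tau>: "strict_mono_on {..n} \<tau>"
    and *: "\<And>w. step_integral xs w =
      (\<Sum>i<n. step_fun xs (\<tau> (Suc i)) * (w (\<tau> (Suc i)) - w (\<tau> i)))"
  shows "integrable lborel (\<lambda>t. (step_fun xs t)\<^sup>2)"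
    and "(\<integral>t. (step_fun xs t)\<^sup>2 \<partial>lborel) =
      (\<Sum>i<n. (step_fun xs (\<tau> (Suc i)))\<^sup>2 * (\<tau> (Suc i) - \<tau> i))"
proof -
  define d where "d i = step_fun xs (\<tau> (Suc i))" for i
  define J where "J i = {\<tau> i<..\<tau> (Suc i)}" for i
  have le: "\<tau> i \<le> \<tau> i'" if "i \<le> i'" "i' \<le> n" for i i'
    using \<tau> that by (simp add: strict_mono_on_less_eq)
  have step: "step_fun xs t = (\<Sum>i<n. d i * indicator (J i) t)" for t
  proof -
    \<comment> \<open>The path that jumps at \<open>t\<close> has increment 1 over exactly the cell
      that contains \<open>t\<close>.\<close>
    have "indicator {t..} (\<tau> (Suc i)) - indicator {t..} (\<tau> i) = (indicator (J i) t :: real)"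
      if "i < n" for i
      using le[of i "Suc i"] that by (auto simp: indicator_def J_def)
    then show ?thesis
      using trans[OF step_fun_eq_step_integral[OF assms(1)] *, of t] by (simp add: d_def)
  qed
  have disj: "indicator (J i) t * indicator (J j) t = (if i = j then indicator (J i) t else 0 :: real)"
    if "i < n" "j < n" for i j t
  proof (cases i j rule: linorder_cases)
    case less
    then have "\<tau> (Suc i) \<le> \<tau> j" using that by (intro le) auto
    then show ?thesis using less by (auto simp: J_def indicator_def)
  next
    case greater
    then have "\<tau> (Suc j) \<le> \<tau> i" using that by (intro le) auto
    then show ?thesis using greater by (auto simp: J_def indicator_def)
  qed (auto simp: indicator_def)
  have sq: "(step_fun xs t)\<^sup>2 = (\<Sum>i<n. (d i)\<^sup>2 * indicator (J i) t)" for t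
  proof -
    have "(step_fun xs t)\<^sup>2 =
        (\<Sum>i<n. \<Sum>j<n. (d i * d j) * (indicator (J i) t * indicator (J j) t))"
      unfolding step power2_eq_square sum_product by (simp add: mult_ac)
    also have "\<dots> = (\<Sum>i<n. \<Sum>j<n. if i = j then (d i)\<^sup>2 * indicator (J i) t else 0)"
      by (intro sum.cong refl) (auto simp: disj power2_eq_square)
    finally show ?thesis by simp
  qed
  have int: "integrable lborel (\<lambda>t. (d i)\<^sup>2 * indicator (J i) t)" if "i < n" for i
    using le[of i "Suc i"] that
    by (intro integrable_mult_right integrable_real_indicator) (auto simp: J_def)
  then show "integrable lborel (\<lambda>t. (step_fun xs t)\<^sup>2)"
    unfolding sq by (intro Bochner_Integration.integrable_sum) simp
  have "(\<integral>t. (step_fun xs t)\<^sup>2 \<partial>lborel) = (\<Sum>i<n. \<integral>t. (d i)\<^sup>2 * indicator (J i) t \<partial>lborel)"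
    unfolding sq using int by (intro Bochner_Integration.integral_sum) simp
  also have "\<dots> = (\<Sum>i<n. (d i)\<^sup>2 * (\<tau> (Suc i) - \<tau> i))"
    using le[of _ "Suc _"] by (intro sum.cong) (auto simp: J_def)
  finally show "(\<integral>t. (step_fun xs t)\<^sup>2 \<partial>lborel) =
      (\<Sum>i<n. (step_fun xs (\<tau> (Suc i)))\<^sup>2 * (\<tau> (Suc i) - \<tau> i))"
    by (simp add: d_def)
qed

lemma integrable_step_fun_square:
  assumes "valid_step xs"
  shows "integrable lborel (\<lambda>t. (step_fun xs t)\<^sup>2)"
  by (rule step_integral_partition[OF assms]) (rule integral_step_fun_square(1)[OF assms])

section \<open>Increments under Wiener measure\<close>

lemma wiener_measure_increment:
  assumes "wiener_measure \<gamma>" "0 \<le> s" "s < t" "t \<le> 1"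
  shows "distributed \<gamma> lborel (\<lambda>w. w t - w s) (normal_density 0 (sqrt (t - s)))"
proof -
  have "\<forall>s t. 0 \<le> s \<and> s < t \<and> t \<le> 1 \<longrightarrow>
      distributed \<gamma> lborel (\<lambda>w. w t - w s) (normal_density 0 (sqrt (t - s)))"
    using assms(1) unfolding wiener_measure_def by (elim conjE)
  from this[THEN spec, THEN spec, THEN mp] assms(2-4) show ?thesis by simp
qed

lemma wiener_measure_indep:
  fixes \<tau> :: "nat \<Rightarrow> real"
  assumes "wiener_measure \<gamma>" "mono_on {..n} \<tau>" "\<tau> ` {..n} \<subseteq> {0..1}"
  shows "prob_space.indep_vars \<gamma> (\<lambda>_. borel) (\<lambda>i w. w (\<tau> (Suc i)) - w (\<tau> i)) {..<n}"
proof -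
  have "\<forall>n (\<tau> :: nat \<Rightarrow> real). mono_on {..n} \<tau> \<and> \<tau> ` {..n} \<subseteq> {0..1} \<longrightarrow>
      prob_space.indep_vars \<gamma> (\<lambda>_. borel) (\<lambda>i w. w (\<tau> (Suc i)) - w (\<tau> i)) {..<n}"
    using assms(1) unfolding wiener_measure_def by (elim conjE)
  from this[THEN spec, THEN spec, THEN mp, OF conjI] assms(2,3) show ?thesis by blast
qed

lemma borel_measurable_increment:
  assumes "wiener_measure \<gamma>" "0 \<le> a" "a \<le> b" "b \<le> 1"
  shows "(\<lambda>w. w b - w a) \<in> borel_measurable \<gamma>"
proof (cases "a < b")
  case True
  then have "distributed \<gamma> lborel (\<lambda>w. w b - w a) (normal_density 0 (sqrt (b - a)))"
    using assms by (intro wiener_measure_increment)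
  then show ?thesis by (auto dest: distributed_measurable)
next
  case False
  then show ?thesis using assms by simp
qed

lemma borel_measurable_step_integral:
  assumes "wiener_measure \<gamma>" "valid_step xs"
  shows "step_integral xs \<in> borel_measurable \<gamma>"
  using assms(2)
proof (induction xs)
  case (Cons x xs)
  obtain c a b where x: "x = (c, a, b)" by (cases x)
  then have "(\<lambda>w. c * (w b - w a) + step_integral xs w) \<in> borel_measurable \<gamma>"
    using Cons borel_measurable_increment[OF assms(1), of a b] by (intro borel_measurable_add) auto
  then show ?case by (simp add: x fun_eq_iff)
next
  case Nil
  have "step_integral [] = (\<lambda>_. 0)" by (rule ext) simp
  then show ?case by simp
qed

text \<open>Over a partition the exponential is a product of independent factors, each with a
  Gaussian moment generating function; the variances add up to the integral of the squared step
  function. The partition is strict because the law of an increment is prescribed for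
  \<open>s < t\<close>.\<close>

lemma step_integral_mgf:
  assumes \<gamma>: "wiener_measure \<gamma>" and xs: "valid_step xs"
  shows "integrable \<gamma> (\<lambda>w. exp (step_integral xs w))"
    and "(\<integral>w. exp (step_integral xs w) \<partial>\<gamma>) = exp ((\<integral>t. (step_fun xs t)\<^sup>2 \<partial>lborel) / 2)"
proof -
  interpret prob_space \<gamma> using \<gamma> by (simp add: wiener_measure_def)
  obtain n and \<tau> :: "nat \<Rightarrow> real" where \<tau>: "strict_mono_on {..n} \<tau>" "\<tau> ` {..n} \<subseteq> {0..1}"
    and *: "\<And>w. step_integral xs w = (\<Sum>i<n. step_fun xs (\<tau> (Suc i)) * (w (\<tau> (Suc i)) - w (\<tau> i)))"
    using step_integral_partition[OF xs] by blast
  define d where "d i = step_fun xs (\<tau> (Suc i))" for i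
  have "mono_on {..n} \<tau>" using \<tau>(1) by (rule strict_mono_on_imp_mono_on)
  with \<tau>(2) have "indep_vars (\<lambda>_. borel) (\<lambda>i w. w (\<tau> (Suc i)) - w (\<tau> i)) {..<n}"
    by (intro wiener_measure_indep[OF \<gamma>])
  then have indep: "indep_vars (\<lambda>_. borel) (\<lambda>i w. exp (d i * (w (\<tau> (Suc i)) - w (\<tau> i)))) {..<n}"
    by (rule indep_vars_compose2) measurable
  have mgf: "integrable \<gamma> (\<lambda>w. exp (d i * (w (\<tau> (Suc i)) - w (\<tau> i)))) \<and>
      (\<integral>w. exp (d i * (w (\<tau> (Suc i)) - w (\<tau> i))) \<partial>\<gamma>) = exp ((d i)\<^sup>2 * (\<tau> (Suc i) - \<tau> i) / 2)"
    if "i < n" for i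
  proof -
    have lt: "\<tau> i < \<tau> (Suc i)" using \<tau>(1) that by (auto simp: strict_mono_on_def)
    have "\<tau> i \<in> {0..1}" "\<tau> (Suc i) \<in> {0..1}" using \<tau>(2) that by (auto simp: image_subset_iff)
    then have D: "distributed \<gamma> lborel (\<lambda>w. w (\<tau> (Suc i)) - w (\<tau> i))
        (normal_density 0 (sqrt (\<tau> (Suc i) - \<tau> i)))"
      using lt by (intro wiener_measure_increment[OF \<gamma>]) auto
    show ?thesis
      using distributed_integrable[OF D, of "\<lambda>x. exp (d i * x)"]
        distributed_integral[OF D, of "\<lambda>x. exp (d i * x)"]
        normal_density_mgf[of "sqrt (\<tau> (Suc i) - \<tau> i)" "d i"] lt
      by auto
  qed
  have exp_eq: "exp (step_integral xs w) = (\<Prod>i<n. exp (d i * (w (\<tau> (Suc i)) - w (\<tau> i))))" for w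
    by (simp add: * d_def exp_sum)
  show "integrable \<gamma> (\<lambda>w. exp (step_integral xs w))"
    unfolding exp_eq by (rule indep_vars_integrable[OF _ indep]) (use mgf in auto)
  have "(\<integral>w. exp (step_integral xs w) \<partial>\<gamma>) =
      (\<Prod>i<n. \<integral>w. exp (d i * (w (\<tau> (Suc i)) - w (\<tau> i))) \<partial>\<gamma>)"
    unfolding exp_eq by (rule indep_vars_lebesgue_integral[OF _ indep]) (use mgf in auto)
  also have "\<dots> = (\<Prod>i<n. exp ((d i)\<^sup>2 * (\<tau> (Suc i) - \<tau> i) / 2))"
    by (rule prod.cong) (use mgf in auto)
  also have "\<dots> = exp ((\<integral>t. (step_fun xs t)\<^sup>2 \<partial>lborel) / 2)"
    unfolding integral_step_fun_square(2)[OF xs \<tau>(1) *]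
    by (simp add: exp_sum d_def sum_divide_distrib)
  finally show "(\<integral>w. exp (step_integral xs w) \<partial>\<gamma>) = exp ((\<integral>t. (step_fun xs t)\<^sup>2 \<partial>lborel) / 2)" .
qed

subsection \<open>Limits of step integrals\<close>

text \<open>A form of \<open>is_wiener_integral_of\<close> suited to calculation: real integrals
  over the whole line with integrability built in, so that squares can be expanded by linearity and
  linear combinations stay inside the notion.\<close>

definition wiener_limit :: "path measure \<Rightarrow> (real \<Rightarrow> real) \<Rightarrow> (path \<Rightarrow> real) \<Rightarrow> bool" where
  "wiener_limit \<gamma> f X \<longleftrightarrow>
     f \<in> borel_measurable lborel \<and> integrable lborel (\<lambda>t. (f t)\<^sup>2) \<and>
     X \<in> borel_measurable (completion \<gamma>) \<and>
     (\<exists>s. (\<forall>n. valid_step (s n)) \<and>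
        (\<forall>n. integrable (completion \<gamma>) (\<lambda>w. (X w - step_integral (s n) w)\<^sup>2)) \<and>
        (\<lambda>n. \<integral>t. (f t - step_fun (s n) t)\<^sup>2 \<partial>lborel) \<longlonglongrightarrow> 0 \<and>
        (\<lambda>n. \<integral>w. (X w - step_integral (s n) w)\<^sup>2 \<partial>completion \<gamma>) \<longlonglongrightarrow> 0)"

lemma wiener_limitE:
  assumes "wiener_limit \<gamma> f X"
  obtains s where "f \<in> borel_measurable lborel" "integrable lborel (\<lambda>t. (f t)\<^sup>2)"
    "X \<in> borel_measurable (completion \<gamma>)" "\<And>n. valid_step (s n)"
    "\<And>n. integrable (completion \<gamma>) (\<lambda>w. (X w - step_integral (s n) w)\<^sup>2)"
    "(\<lambda>n. \<integral>t. (f t - step_fun (s n) t)\<^sup>2 \<partial>lborel) \<longlonglongrightarrow> 0"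
    "(\<lambda>n. \<integral>w. (X w - step_integral (s n) w)\<^sup>2 \<partial>completion \<gamma>) \<longlonglongrightarrow> 0"
  using assms unfolding wiener_limit_def by (elim conjE exE) (rule that, auto)

lemma integrable_square_diff_step_fun:
  assumes "f \<in> borel_measurable lborel" "integrable lborel (\<lambda>t. (f t)\<^sup>2)" "valid_step xs"
  shows "integrable lborel (\<lambda>t. (f t - step_fun xs t)\<^sup>2)"
  using integrable_square_lincomb(1)[OF assms(1) _ assms(2) integrable_step_fun_square[OF assms(3)],
      of 1 "-1"] by simp

lemma wiener_limit_lincomb:
  assumes \<gamma>: "wiener_measure \<gamma>" and "wiener_limit \<gamma> f X" "wiener_limit \<gamma> g Y"
  shows "wiener_limit \<gamma> (\<lambda>t. c * f t + d * g t) (\<lambda>w. c * X w + d * Y w)"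
proof -
  obtain s where f [measurable]: "f \<in> borel_measurable lborel" and f2: "integrable lborel (\<lambda>t. (f t)\<^sup>2)"
    and X [measurable]: "X \<in> borel_measurable (completion \<gamma>)" and s: "\<And>n. valid_step (s n)"
    and X2: "\<And>n. integrable (completion \<gamma>) (\<lambda>w. (X w - step_integral (s n) w)\<^sup>2)"
    and fs: "(\<lambda>n. \<integral>t. (f t - step_fun (s n) t)\<^sup>2 \<partial>lborel) \<longlonglongrightarrow> 0"
    and Xs: "(\<lambda>n. \<integral>w. (X w - step_integral (s n) w)\<^sup>2 \<partial>completion \<gamma>) \<longlonglongrightarrow> 0"
    using assms(2) by (rule wiener_limitE) (rule that; assumption)
  obtain r where g [measurable]: "g \<in> borel_measurable lborel" and g2: "integrable lborel (\<lambda>t. (g t)\<^sup>2)"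
    and Y [measurable]: "Y \<in> borel_measurable (completion \<gamma>)" and r: "\<And>n. valid_step (r n)"
    and Y2: "\<And>n. integrable (completion \<gamma>) (\<lambda>w. (Y w - step_integral (r n) w)\<^sup>2)"
    and gr: "(\<lambda>n. \<integral>t. (g t - step_fun (r n) t)\<^sup>2 \<partial>lborel) \<longlonglongrightarrow> 0"
    and Yr: "(\<lambda>n. \<integral>w. (Y w - step_integral (r n) w)\<^sup>2 \<partial>completion \<gamma>) \<longlonglongrightarrow> 0"
    using assms(3) by (rule wiener_limitE) (rule that; assumption)
  define q where "q n = step_scale c (s n) @ step_scale d (r n)" for n
  have meas: "(\<lambda>w. X w - step_integral (s n) w) \<in> borel_measurable (completion \<gamma>)"
    "(\<lambda>w. Y w - step_integral (r n) w) \<in> borel_measurable (completion \<gamma>)" for n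
    using measurable_completion[OF borel_measurable_step_integral[OF \<gamma> s]]
      measurable_completion[OF borel_measurable_step_integral[OF \<gamma> r]]
    by (intro borel_measurable_diff X Y; blast)+
  have step: "c * f t + d * g t - step_fun (q n) t =
      c * (f t - step_fun (s n) t) + d * (g t - step_fun (r n) t)" for n t
    by (simp add: q_def algebra_simps)
  have int: "c * X w + d * Y w - step_integral (q n) w =
      c * (X w - step_integral (s n) w) + d * (Y w - step_integral (r n) w)" for n w
    by (simp add: q_def algebra_simps)
  show ?thesis
    unfolding wiener_limit_def
  proof (intro conjI exI[of _ q] allI)
    show "integrable lborel (\<lambda>t. (c * f t + d * g t)\<^sup>2)"
      by (rule integrable_square_lincomb(1)[OF f g f2 g2])
    show "valid_step (q n)" for n by (simp add: q_def s r)
    show "integrable (completion \<gamma>) (\<lambda>w. (c * X w + d * Y w - step_integral (q n) w)\<^sup>2)" for n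
      unfolding int by (rule integrable_square_lincomb(1)[OF meas X2 Y2])
    show "(\<lambda>n. \<integral>t. (c * f t + d * g t - step_fun (q n) t)\<^sup>2 \<partial>lborel) \<longlonglongrightarrow> 0"
      unfolding step
      by (rule integral_square_tendsto_zero_lincomb)
         (use fs gr integrable_square_diff_step_fun[OF f f2 s]
            integrable_square_diff_step_fun[OF g g2 r] in \<open>simp_all\<close>)
    show "(\<lambda>n. \<integral>w. (c * X w + d * Y w - step_integral (q n) w)\<^sup>2 \<partial>completion \<gamma>) \<longlonglongrightarrow> 0"
      unfolding int
      by (rule integral_square_tendsto_zero_lincomb) (rule meas X2 Y2 Xs Yr)+
  qed simp_all
qed

lemma wiener_limit_zero: "wiener_limit \<gamma> (\<lambda>_. 0) (\<lambda>_. 0)"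
  unfolding wiener_limit_def by (auto intro!: exI[of _ "\<lambda>_. []"])

text \<open>Convergence in L^2 implies convergence of the norms: the step function is
  \<open>f\<close> minus an error, and Cauchy-Schwarz removes the cross term.\<close>

lemma tendsto_integral_step_fun_square:
  assumes f: "f \<in> borel_measurable lborel" "integrable lborel (\<lambda>t. (f t)\<^sup>2)"
    and s: "\<And>n. valid_step (s n)"
    and lim: "(\<lambda>n. \<integral>t. (f t - step_fun (s n) t)\<^sup>2 \<partial>lborel) \<longlonglongrightarrow> 0"
  shows "(\<lambda>n. \<integral>t. (step_fun (s n) t)\<^sup>2 \<partial>lborel) \<longlonglongrightarrow> (\<integral>t. (f t)\<^sup>2 \<partial>lborel)"
proof -
  define D where "D n t = f t - step_fun (s n) t" for n t
  have D [measurable]: "D n \<in> borel_measurable lborel" for n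
    unfolding D_def using f(1) by measurable
  have D2: "integrable lborel (\<lambda>t. (D n t)\<^sup>2)" for n
    unfolding D_def by (rule integrable_square_diff_step_fun[OF f s])
  have lim: "(\<lambda>n. \<integral>t. (D n t)\<^sup>2 \<partial>lborel) \<longlonglongrightarrow> 0"
    unfolding D_def by (rule lim)
  have "(\<lambda>n. sqrt ((\<integral>t. (f t)\<^sup>2 \<partial>lborel) * (\<integral>t. (D n t)\<^sup>2 \<partial>lborel))) \<longlonglongrightarrow>
      sqrt ((\<integral>t. (f t)\<^sup>2 \<partial>lborel) * 0)"
    using lim by (intro tendsto_intros)
  then have bound: "(\<lambda>n. sqrt ((\<integral>t. (f t)\<^sup>2 \<partial>lborel) * (\<integral>t. (D n t)\<^sup>2 \<partial>lborel))) \<longlonglongrightarrow> 0"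
    by simp
  have cross: "(\<lambda>n. \<integral>t. f t * D n t \<partial>lborel) \<longlonglongrightarrow> 0"
  proof (rule Lim_null_comparison[OF always_eventually bound], rule allI)
    fix n
    show "norm (\<integral>t. f t * D n t \<partial>lborel) \<le>
        sqrt ((\<integral>t. (f t)\<^sup>2 \<partial>lborel) * (\<integral>t. (D n t)\<^sup>2 \<partial>lborel))"
      unfolding real_norm_def by (rule integral_Cauchy_Schwarz) (rule f D D2)+
  qed
  have "(\<integral>t. (step_fun (s n) t)\<^sup>2 \<partial>lborel) =
      1\<^sup>2 * (\<integral>t. (f t)\<^sup>2 \<partial>lborel) + 2 * 1 * (-1) * (\<integral>t. f t * D n t \<partial>lborel) +
      (-1)\<^sup>2 * (\<integral>t. (D n t)\<^sup>2 \<partial>lborel)" for n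
    unfolding integrable_square_lincomb(2)[OF f(1) D f(2) D2, symmetric] by (simp add: D_def)
  moreover have "(\<lambda>n. 1\<^sup>2 * (\<integral>t. (f t)\<^sup>2 \<partial>lborel) + 2 * 1 * (-1) * (\<integral>t. f t * D n t \<partial>lborel) +
      (-1)\<^sup>2 * (\<integral>t. (D n t)\<^sup>2 \<partial>lborel)) \<longlonglongrightarrow>
      1\<^sup>2 * (\<integral>t. (f t)\<^sup>2 \<partial>lborel) + 2 * 1 * (-1) * 0 + (-1)\<^sup>2 * 0"
    using cross lim by (intro tendsto_intros)
  ultimately show ?thesis by simp
qed

text \<open>Convexity: the graph of exp lies above its tangents. The bound is a product of a factor
  that will be small in L^2 and one that will be bounded in L^2.\<close>

lemma abs_exp_diff_le: "\<bar>exp x - exp y\<bar> \<le> \<bar>x - y\<bar> * (exp x + exp (y :: real))"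
proof -
  have *: "exp a - exp b \<le> (a - b) * exp a" for a b :: real
  proof -
    have "(1 + (b - a)) * exp a \<le> exp (b - a) * exp a"
      by (intro mult_right_mono exp_ge_add_one_self) simp
    then show ?thesis by (simp add: exp_diff algebra_simps)
  qed
  have "(x - y) * exp x \<le> \<bar>x - y\<bar> * (exp x + exp y)" "(y - x) * exp y \<le> \<bar>x - y\<bar> * (exp x + exp y)"
    by (intro mult_mono; simp)+
  then show ?thesis using *[of x y] *[of y x] by linarith
qed

text \<open>The exponentials of the step integrals are Gaussian, hence bounded in \<open>L\<^sup>2\<close>; by Fatou the
  limit inherits square integrability, and Cauchy-Schwarz upgrades the \<open>L\<^sup>2\<close> convergence of the
  exponents to convergence of the expectations of the exponentials.\<close>

lemma wiener_limit_mgf: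
  assumes \<gamma>: "wiener_measure \<gamma>" and lim: "wiener_limit \<gamma> f X"
  shows "integrable (completion \<gamma>) (\<lambda>w. exp (X w))"
    and "(\<integral>w. exp (X w) \<partial>completion \<gamma>) = exp ((\<integral>t. (f t)\<^sup>2 \<partial>lborel) / 2)"
proof -
  interpret prob_space \<gamma> using \<gamma> by (simp add: wiener_measure_def)
  let ?N = "completion \<gamma>"
  interpret N: prob_space ?N by (rule prob_space_completion)
  obtain s where f: "f \<in> borel_measurable lborel" "integrable lborel (\<lambda>t. (f t)\<^sup>2)"
    and X [measurable]: "X \<in> borel_measurable ?N" and s: "\<And>n. valid_step (s n)"
    and X2: "\<And>n. integrable ?N (\<lambda>w. (X w - step_integral (s n) w)\<^sup>2)"
    and fs: "(\<lambda>n. \<integral>t. (f t - step_fun (s n) t)\<^sup>2 \<partial>lborel) \<longlonglongrightarrow> 0"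
    and Xs: "(\<lambda>n. \<integral>w. (X w - step_integral (s n) w)\<^sup>2 \<partial>?N) \<longlonglongrightarrow> 0"
    using lim by (rule wiener_limitE) (rule that; assumption)
  define S where "S n = step_integral (s n)" for n
  define v where "v n = (\<integral>t. (step_fun (s n) t)\<^sup>2 \<partial>lborel)" for n
  define V where "V = (\<integral>t. (f t)\<^sup>2 \<partial>lborel)"
  have v: "v \<longlonglongrightarrow> V"
    unfolding v_def V_def by (rule tendsto_integral_step_fun_square[OF f s fs])
  have S0: "S n \<in> borel_measurable \<gamma>" for n
    unfolding S_def by (rule borel_measurable_step_integral[OF \<gamma> s])
  have S [measurable]: "S n \<in> borel_measurable ?N" for n
    by (rule measurable_completion[OF S0])
  \<comment> \<open>The value \<open>d = 1\<close> gives the expectations whose limit is sought,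
    \<open>d = 2\<close> the second moments of the exponentials.\<close>
  have mgf: "integrable ?N (\<lambda>w. exp (d * S n w)) \<and> (\<integral>w. exp (d * S n w) \<partial>?N) = exp (d\<^sup>2 * v n / 2)" for d n
  proof -
    have "(\<lambda>w. exp (d * S n w)) \<in> borel_measurable \<gamma>" using S0[of n] by measurable
    then show ?thesis
      using step_integral_mgf[OF \<gamma>, of "step_scale d (s n)"] s[of n]
      by (simp add: integrable_completion integral_completion S_def v_def power_mult_distrib)
  qed
  have Xs: "(\<lambda>n. \<integral>w. (X w - S n w)\<^sup>2 \<partial>?N) \<longlonglongrightarrow> 0" and X2: "\<And>n. integrable ?N (\<lambda>w. (X w - S n w)\<^sup>2)"
    using Xs X2 by (simp_all add: S_def)
  \<comment> \<open>Fatou's lemma needs pointwise limits; L^2 convergence supplies them almost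
    everywhere along a subsequence, which suffices for a bound on the limit.\<close>
  obtain r :: "nat \<Rightarrow> nat" where r: "strict_mono r" and r0: "AE w in ?N. (\<lambda>n. X w - S (r n) w) \<longlonglongrightarrow> 0"
    using tendsto_L1_AE_subseq[of ?N "\<lambda>n w. (X w - S n w)\<^sup>2", OF X2] Xs by auto
  from r0 have AE: "AE w in ?N. (\<lambda>n. S (r n) w) \<longlonglongrightarrow> X w"
  proof eventually_elim
    case (elim w)
    from tendsto_diff[OF tendsto_const[of "X w"] elim] show ?case by simp
  qed
  have "(\<integral>\<^sup>+w. ennreal (exp (2 * X w)) \<partial>?N) = (\<integral>\<^sup>+w. liminf (\<lambda>n. ennreal (exp (2 * S (r n) w))) \<partial>?N)"
  proof (rule nn_integral_cong_AE, use AE in eventually_elim)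
    case (elim w)
    then have "(\<lambda>n. ennreal (exp (2 * S (r n) w))) \<longlonglongrightarrow> ennreal (exp (2 * X w))"
      by (intro tendsto_intros)
    from lim_imp_Liminf[OF sequentially_bot this] show ?case by simp
  qed
  also have "\<dots> \<le> liminf (\<lambda>n. \<integral>\<^sup>+w. ennreal (exp (2 * S (r n) w)) \<partial>?N)"
    by (intro nn_integral_liminf) measurable
  also have "\<dots> = liminf (\<lambda>n. ennreal (exp (2\<^sup>2 * v (r n) / 2)))"
    using mgf[of 2] by (subst nn_integral_eq_integral) auto
  also have "\<dots> = ennreal (exp (2\<^sup>2 * V / 2))"
    using LIMSEQ_subseq_LIMSEQ[OF v r]
    by (intro lim_imp_Liminf) (auto intro!: tendsto_intros simp: o_def)
  also have "\<dots> < \<infinity>" by simp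
  finally have E2: "integrable ?N (\<lambda>w. exp (2 * X w))"
    by (intro integrableI_nonneg) auto
  have sq: "(exp a)\<^sup>2 = exp (2 * a)" for a :: real by (simp add: exp_double)
  define T where "T n w = 1 * exp (X w) + 1 * exp (S n w)" for n w
  have EX2: "integrable ?N (\<lambda>w. (exp (X w))\<^sup>2)" and ES2: "\<And>n. integrable ?N (\<lambda>w. (exp (S n w))\<^sup>2)"
    using E2 mgf[of 2] by (simp_all add: sq)
  have mX: "(\<lambda>w. exp (X w)) \<in> borel_measurable ?N" and mS: "\<And>n. (\<lambda>w. exp (S n w)) \<in> borel_measurable ?N"
    by measurable
  show int: "integrable ?N (\<lambda>w. exp (X w))"
    by (rule N.square_integrable_imp_integrable[OF mX EX2])
  have T [measurable]: "T n \<in> borel_measurable ?N" for n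
    unfolding T_def by measurable
  have T2: "integrable ?N (\<lambda>w. (T n w)\<^sup>2)" for n
    unfolding T_def by (rule integrable_square_lincomb(1)[OF mX mS EX2 ES2])
  \<comment> \<open>The bound comes from \<open>(a + b)^2 \<le> 2 a^2 + 2 b^2\<close>. Since
    \<open>v\<close> converges, so does \<open>K\<close>, and the product with the vanishing L^2
    error tends to 0.\<close>
  define K where "K n = 2 * (\<integral>w. (exp (X w))\<^sup>2 \<partial>?N) + 2 * exp (2\<^sup>2 * v n / 2)" for n
  have TK: "(\<integral>w. (T n w)\<^sup>2 \<partial>?N) \<le> K n" for n
  proof -
    have "(\<integral>w. (T n w)\<^sup>2 \<partial>?N) \<le> (\<integral>w. 2 * (exp (X w))\<^sup>2 + 2 * (exp (S n w))\<^sup>2 \<partial>?N)"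
    proof (rule integral_mono)
      show "(T n w)\<^sup>2 \<le> 2 * (exp (X w))\<^sup>2 + 2 * (exp (S n w))\<^sup>2" for w
        using sum_squares_bound[of "exp (X w)" "exp (S n w)"]
        by (simp add: T_def power2_sum)
    qed (use T2 EX2 ES2 in auto)
    also have "\<dots> = K n"
      using EX2 ES2 mgf[of 2 n] by (simp add: K_def sq)
    finally show ?thesis .
  qed
  have "K \<longlonglongrightarrow> 2 * (\<integral>w. (exp (X w))\<^sup>2 \<partial>?N) + 2 * exp (2\<^sup>2 * V / 2)"
    unfolding K_def using v by (intro tendsto_intros) auto
  from tendsto_real_sqrt[OF tendsto_mult[OF Xs this]]
  have bound: "(\<lambda>n. sqrt ((\<integral>w. (X w - S n w)\<^sup>2 \<partial>?N) * K n)) \<longlonglongrightarrow> 0" by simp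
  have "(\<lambda>n. (\<integral>w. exp (X w) \<partial>?N) - (\<integral>w. exp (S n w) \<partial>?N)) \<longlonglongrightarrow> 0"
  proof (rule Lim_null_comparison[OF always_eventually bound], rule allI)
    fix n
    have D: "(\<lambda>w. \<bar>X w - S n w\<bar>) \<in> borel_measurable ?N" by measurable
    have D2: "integrable ?N (\<lambda>w. \<bar>X w - S n w\<bar>\<^sup>2)" using X2 by simp
    have intS: "integrable ?N (\<lambda>w. exp (S n w))" using mgf[of 1 n] by simp
    have "norm ((\<integral>w. exp (X w) \<partial>?N) - (\<integral>w. exp (S n w) \<partial>?N)) = \<bar>\<integral>w. exp (X w) - exp (S n w) \<partial>?N\<bar>"
      using int intS by simp
    also have "\<dots> \<le> (\<integral>w. \<bar>exp (X w) - exp (S n w)\<bar> \<partial>?N)" by (rule integral_abs_bound)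
    also have "\<dots> \<le> (\<integral>w. \<bar>X w - S n w\<bar> * T n w \<partial>?N)"
    proof (rule integral_mono)
      show "integrable ?N (\<lambda>w. \<bar>X w - S n w\<bar> * T n w)"
        by (rule integrable_square_mult[OF D T D2 T2])
      show "\<bar>exp (X w) - exp (S n w)\<bar> \<le> \<bar>X w - S n w\<bar> * T n w" for w
        using abs_exp_diff_le[of "X w" "S n w"] by (simp add: T_def)
    qed (use int intS in simp)
    also have "\<dots> \<le> sqrt ((\<integral>w. \<bar>X w - S n w\<bar>\<^sup>2 \<partial>?N) * (\<integral>w. (T n w)\<^sup>2 \<partial>?N))"
      using integral_Cauchy_Schwarz[OF D T D2 T2, of n] by linarith
    also have "\<dots> \<le> sqrt ((\<integral>w. (X w - S n w)\<^sup>2 \<partial>?N) * K n)"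
      using TK[of n] by (intro real_sqrt_le_mono) (simp add: mult_left_mono)
    finally show "norm ((\<integral>w. exp (X w) \<partial>?N) - (\<integral>w. exp (S n w) \<partial>?N)) \<le>
        sqrt ((\<integral>w. (X w - S n w)\<^sup>2 \<partial>?N) * K n)" .
  qed
  from tendsto_diff[OF tendsto_const[of "\<integral>w. exp (X w) \<partial>?N"] this]
  have "(\<lambda>n. \<integral>w. exp (S n w) \<partial>?N) \<longlonglongrightarrow> (\<integral>w. exp (X w) \<partial>?N)" by simp
  moreover have "(\<integral>w. exp (S n w) \<partial>?N) = exp (v n / 2)" for n using mgf[of 1 n] by simp
  moreover have "(\<lambda>n. exp (v n / 2)) \<longlonglongrightarrow> exp (V / 2)" using v by (intro tendsto_intros) auto
  ultimately show "(\<integral>w. exp (X w) \<partial>?N) = exp ((\<integral>t. (f t)\<^sup>2 \<partial>lborel) / 2)"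
    unfolding V_def[symmetric] by (simp add: LIMSEQ_unique)
qed

lemma is_wiener_integral_of_imp_wiener_limit:
  assumes \<gamma>: "wiener_measure \<gamma>" and X: "is_wiener_integral_of \<gamma> f X"
    and f: "set_borel_measurable lborel {0..1} f" "set_integrable lborel {0..1} (\<lambda>t. (f t)\<^sup>2)"
  shows "wiener_limit \<gamma> (\<lambda>t. indicator {0..1} t * f t) X"
proof -
  let ?N = "completion \<gamma>"
  define g where "g t = indicator {0..1} t * f t" for t :: real
  have g [measurable]: "g \<in> borel_measurable lborel"
    using f(1) by (simp add: set_borel_measurable_def g_def [abs_def])
  have g2: "integrable lborel (\<lambda>t. (g t)\<^sup>2)"
  proof -
    have "(\<lambda>t. (g t)\<^sup>2) = (\<lambda>t. indicator {0..1} t *\<^sub>R (f t)\<^sup>2)"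
      by (auto simp: g_def indicator_def)
    then show ?thesis using f(2) by (simp add: set_integrable_def)
  qed
  obtain s :: "nat \<Rightarrow> (real \<times> real \<times> real) list" where mX [measurable]: "X \<in> borel_measurable ?N"
    and s: "\<And>n. valid_step (s n)"
    and fs: "(\<lambda>n. \<integral>\<^sup>+t\<in>{0..1}. ennreal ((f t - step_fun (s n) t)\<^sup>2) \<partial>lborel) \<longlonglongrightarrow> 0"
    and Xs: "(\<lambda>n. \<integral>\<^sup>+w. ennreal ((X w - step_integral (s n) w)\<^sup>2) \<partial>?N) \<longlonglongrightarrow> 0"
    using X unfolding is_wiener_integral_of_def by (elim conjE exE) (rule that, auto)
  have mS [measurable]: "step_integral (s n) \<in> borel_measurable ?N" for n
    by (rule measurable_completion[OF borel_measurable_step_integral[OF \<gamma> s]])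
  have "\<forall>\<^sub>F n in sequentially. (\<integral>\<^sup>+w. ennreal ((X w - step_integral (s n) w)\<^sup>2) \<partial>?N) < \<infinity>"
    by (rule order_tendstoD(2)[OF Xs]) simp
  \<comment> \<open>Convergence to 0 in the extended reals allows finitely many infinite terms.
    Dropping an initial segment makes every square integrable.\<close>
  then obtain n0 where n0: "\<And>n. n \<ge> n0 \<Longrightarrow> (\<integral>\<^sup>+w. ennreal ((X w - step_integral (s n) w)\<^sup>2) \<partial>?N) < \<infinity>"
    by (auto simp: eventually_sequentially)
  define q where "q n = s (n + n0)" for n
  have X2: "integrable ?N (\<lambda>w. (X w - step_integral (q n) w)\<^sup>2)" for n
    unfolding q_def using n0[of "n + n0"] by (intro integrableI_nonneg) auto
  have g2': "integrable lborel (\<lambda>t. (g t - step_fun (q n) t)\<^sup>2)" for n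
    unfolding q_def by (rule integrable_square_diff_step_fun[OF g g2 s])
  \<comment> \<open>Off the unit interval both \<open>g\<close> and the valid step functions vanish,
    so the integral may run over the whole line.\<close>
  have "(\<integral>\<^sup>+t\<in>{0..1}. ennreal ((f t - step_fun (s n) t)\<^sup>2) \<partial>lborel) =
      (\<integral>\<^sup>+t. ennreal ((g t - step_fun (s n) t)\<^sup>2) \<partial>lborel)" for n
    by (rule nn_integral_cong) (use step_fun_outside[OF s] in \<open>auto simp: g_def indicator_def\<close>)
  then have "(\<lambda>n. \<integral>\<^sup>+t. ennreal ((g t - step_fun (q n) t)\<^sup>2) \<partial>lborel) \<longlonglongrightarrow> 0"
    using LIMSEQ_ignore_initial_segment[OF fs, of n0] by (simp add: q_def)
  then have gq: "(\<lambda>n. \<integral>t. (g t - step_fun (q n) t)\<^sup>2 \<partial>lborel) \<longlonglongrightarrow> 0"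
    using g2' by (simp add: nn_integral_eq_integral tendsto_ennreal_iff flip: ennreal_0)
  have "(\<lambda>n. \<integral>\<^sup>+w. ennreal ((X w - step_integral (q n) w)\<^sup>2) \<partial>?N) \<longlonglongrightarrow> 0"
    using LIMSEQ_ignore_initial_segment[OF Xs, of n0] by (simp add: q_def)
  then have Xq: "(\<lambda>n. \<integral>w. (X w - step_integral (q n) w)\<^sup>2 \<partial>?N) \<longlonglongrightarrow> 0"
    using X2 by (simp add: nn_integral_eq_integral tendsto_ennreal_iff flip: ennreal_0)
  have "wiener_limit \<gamma> g X"
    unfolding wiener_limit_def using g g2 mX X2 gq Xq s by (auto simp: q_def intro!: exI[of _ q])
  then show ?thesis by (simp add: g_def [abs_def])
qed

subsection \<open>Products and exponentials\<close>

text \<open>Extension by 0 turns the Cameron-Martin inner product into an integral over the whole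
  line, in the form used by \<open>wiener_limit\<close>.\<close>

definition cm_density :: "path \<Rightarrow> real \<Rightarrow> real" where
  "cm_density h t = indicator {0..1} t * path_deriv h t"

lemma cm_inner_eq: "cm_inner g h = (\<integral>t. cm_density g t * cm_density h t \<partial>lborel)"
proof -
  have "indicator {0..1} t *\<^sub>R (path_deriv g t * path_deriv h t) = cm_density g t * cm_density h t" for t
    by (auto simp: cm_density_def indicator_def)
  then show ?thesis by (simp add: cm_inner_def set_lebesgue_integral_def)
qed

text \<open>The induction rule splits off one factor at a time, matching the one factor that each
  differentiation of an exponential brings down.\<close>

inductive_set products :: "('a \<Rightarrow> real) set \<Rightarrow> ('a \<Rightarrow> real) set" for V where
  one: "(\<lambda>_. 1) \<in> products V"
| mult: "M \<in> V \<Longrightarrow> G \<in> products V \<Longrightarrow> (\<lambda>w. M w * G w) \<in> products V"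

lemma products_power_mult:
  assumes "M \<in> V" "G \<in> products V"
  shows "(\<lambda>w. M w ^ k * G w) \<in> products V"
proof (induction k)
  case (Suc k)
  from products.mult[OF assms(1) this] show ?case by (simp add: mult.assoc)
qed (simp add: assms)

lemma products_prod_power:
  assumes "finite A" "\<And>i. i \<in> A \<Longrightarrow> M i \<in> V"
  shows "(\<lambda>w. \<Prod>i\<in>A. M i w ^ k i) \<in> products V"
  using assms
proof (induction A)
  case (insert i A)
  from products_power_mult[of "M i" V, OF insert.prems[of i] insert.IH, of "k i"] insert
  show ?case by simp
qed (simp add: products.one)

text \<open>The bound does not depend on \<open>h\<close>, so it dominates all difference quotients
  at once.\<close>

lemma abs_exp_diff_quotient_le:
  fixes x h :: real
  assumes "0 < h" "h \<le> 1"
  shows "\<bar>(exp (h * x) - 1) / h\<bar> \<le> \<bar>x\<bar> * exp \<bar>x\<bar>"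
proof -
  have *: "\<bar>exp y - 1\<bar> \<le> \<bar>y\<bar> * exp \<bar>y\<bar>" for y :: real
  proof (cases "y \<ge> 0")
    case True
    have "(1 + (- y)) * exp y \<le> exp (- y) * exp y"
      by (intro mult_right_mono exp_ge_add_one_self) simp
    then show ?thesis using True by (simp add: exp_minus algebra_simps)
  next
    case False
    have "1 - exp y \<le> - y * 1" using exp_ge_add_one_self[of y] by linarith
    also have "\<dots> \<le> - y * exp (- y)" using False by (intro mult_left_mono) auto
    finally show ?thesis using False by simp
  qed
  have "\<bar>exp (h * x) - 1\<bar> \<le> \<bar>h * x\<bar> * exp \<bar>h * x\<bar>" by (rule *)
  also have "\<dots> \<le> \<bar>h * x\<bar> * exp \<bar>x\<bar>"
    using assms by (intro mult_left_mono) (auto simp: abs_mult mult_left_le_one_le)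
  finally show ?thesis using assms by (simp add: abs_mult field_simps)
qed

text \<open>Differentiation under the integral at 0, along one sequence of increments so that
  dominated convergence applies directly.\<close>

lemma tendsto_integral_exp_diff_quotient:
  fixes P M :: "'a \<Rightarrow> real"
  assumes [measurable]: "P \<in> borel_measurable N" "M \<in> borel_measurable N"
    and int: "integrable N P" "\<And>h. integrable N (\<lambda>w. exp (h * M w) * P w)"
    and dom: "integrable N (\<lambda>w. \<bar>M w * P w\<bar> * exp \<bar>M w\<bar>)"
  shows "(\<lambda>n. ((\<integral>w. exp (inverse (real (Suc n)) * M w) * P w \<partial>N) - (\<integral>w. P w \<partial>N)) /
      inverse (real (Suc n))) \<longlonglongrightarrow> (\<integral>w. M w * P w \<partial>N)"
proof -
  define h where "h n = inverse (real (Suc n))" for n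
  have h: "0 < h n" "h n \<le> 1" for n by (auto simp: h_def inverse_le_1_iff)
  have "((\<integral>w. exp (h n * M w) * P w \<partial>N) - (\<integral>w. P w \<partial>N)) / h n =
      (\<integral>w. (exp (h n * M w) - 1) / h n * P w \<partial>N)" for n
  proof -
    have "(\<integral>w. exp (h n * M w) * P w \<partial>N) - (\<integral>w. P w \<partial>N) = (\<integral>w. exp (h n * M w) * P w - P w \<partial>N)"
      using int by simp
    then have "((\<integral>w. exp (h n * M w) * P w \<partial>N) - (\<integral>w. P w \<partial>N)) / h n =
        (\<integral>w. (exp (h n * M w) * P w - P w) / h n \<partial>N)"
      by simp
    then show ?thesis by (simp add: algebra_simps)
  qed
  moreover have "(\<lambda>n. \<integral>w. (exp (h n * M w) - 1) / h n * P w \<partial>N) \<longlonglongrightarrow> (\<integral>w. M w * P w \<partial>N)"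
  proof (rule integral_dominated_convergence[OF _ _ dom])
    show "AE w in N. (\<lambda>n. (exp (h n * M w) - 1) / h n * P w) \<longlonglongrightarrow> M w * P w"
    proof (rule AE_I2)
      fix w
      have "((\<lambda>x. exp (x * M w)) has_field_derivative M w) (at 0)"
        by (auto intro!: derivative_eq_intros)
      then have "(\<lambda>x. (exp (x * M w) - 1) / x) \<midarrow>0\<rightarrow> M w"
        by (simp add: has_field_derivative_iff)
      moreover have "filterlim h (at 0) sequentially"
      proof (rule filterlim_atI)
        show "h \<longlonglongrightarrow> 0" unfolding h_def [abs_def] by (rule LIMSEQ_inverse_real_of_nat)
      qed (simp add: h(1) less_imp_neq [symmetric])
      ultimately have "(\<lambda>n. (exp (h n * M w) - 1) / h n) \<longlonglongrightarrow> M w"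
        by (rule filterlim_compose)
      then show "(\<lambda>n. (exp (h n * M w) - 1) / h n * P w) \<longlonglongrightarrow> M w * P w"
        by (intro tendsto_intros)
    qed
    show "AE w in N. norm ((exp (h n * M w) - 1) / h n * P w) \<le> \<bar>M w * P w\<bar> * exp \<bar>M w\<bar>" for n
    proof (rule AE_I2)
      fix w
      have "\<bar>(exp (h n * M w) - 1) / h n\<bar> * \<bar>P w\<bar> \<le> (\<bar>M w\<bar> * exp \<bar>M w\<bar>) * \<bar>P w\<bar>"
        by (intro mult_right_mono abs_exp_diff_quotient_le h) simp
      then show "norm ((exp (h n * M w) - 1) / h n * P w) \<le> \<bar>M w * P w\<bar> * exp \<bar>M w\<bar>"
        by (simp add: abs_mult mult_ac)
    qed
  qed measurable
  ultimately show ?thesis by (simp add: h_def)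
qed

subsection \<open>A unit direction in the Cameron-Martin space\<close>

locale cameron_martin_direction =
  fixes \<gamma> :: "path measure" and I :: "path \<Rightarrow> path \<Rightarrow> real" and \<theta> :: path
  assumes wiener_measure: "wiener_measure \<gamma>"
    and wiener_integral: "wiener_integral \<gamma> I"
    and direction: "\<theta> \<in> cameron_martin"
    and norm_1: "cm_norm \<theta> = 1"
begin

section \<open>Shifts along \<theta>, the derivative and its adjoint\<close>

lemma direction_wiener_paths: "\<theta> \<in> wiener_paths"
  using direction by (simp add: cameron_martin_def)

lemma wiener_integral_shift:
  assumes "h \<in> cameron_martin" "w \<in> wiener_paths"
  shows "I h (path_add w \<theta>) = I h w + cm_inner h \<theta>"
  using wiener_integral direction assms by (simp add: wiener_integral_def)

lemma wiener_integral_shift_scale: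
  assumes "h \<in> cameron_martin" "w \<in> wiener_paths"
  shows "I h (path_add w (path_scale \<epsilon> \<theta>)) = I h w + \<epsilon> * cm_inner h \<theta>"
  using wiener_integral path_scale_cameron_martin[OF direction] assms
  by (simp add: wiener_integral_def cm_inner_path_scale)

lemma cm_inner_direction: "cm_inner \<theta> \<theta> = 1"
  using norm_1 by (simp add: cm_norm_def)

text \<open>Since \<theta> has norm 1, \<open>[\<theta>]\<close> grows with slope exactly 1 along
  the line, so the directional derivative acts on polynomials in \<open>[\<theta>]\<close> as the
  ordinary derivative.\<close>

lemma dir_deriv_adj_poly:
  assumes G: "\<And>w. w \<in> wiener_paths \<Longrightarrow> G w = poly q (I \<theta> w)" and w: "w \<in> wiener_paths"
  shows "dir_deriv_adj I \<theta> G w = poly (pCons 0 q - pderiv q) (I \<theta> w)"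
proof -
  have "G (path_add w (path_scale \<epsilon> \<theta>)) = poly (q \<circ>\<^sub>p [:I \<theta> w, 1:]) \<epsilon>" for \<epsilon>
    using w direction_wiener_paths direction
    by (simp add: G path_add_wiener_paths path_scale_wiener_paths wiener_integral_shift_scale
        cm_inner_direction poly_pcompose)
  from dir_deriv_poly[OF this, of 0] have "dir_deriv \<theta> G w = poly (pderiv q) (I \<theta> w)"
    using w by (simp add: path_add_path_scale_0 pderiv_pcompose poly_pcompose pderiv_pCons)
  then show ?thesis using w by (simp add: dir_deriv_adj_def G)
qed

lemma higher_dir_deriv_adj_1:
  "w \<in> wiener_paths \<Longrightarrow> (dir_deriv_adj I \<theta> ^^ n) (\<lambda>_. 1) w = poly (hermite n) (I \<theta> w)"
proof (induction n arbitrary: w)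
  case (Suc n)
  show ?case
    using dir_deriv_adj_poly[OF Suc.IH Suc.prems] by (simp add: hermite_eq_hermite_rec)
qed (simp add: hermite_eq_hermite_rec)

lemma exp_term_dir_deriv_adj_sums:
  assumes "w \<in> wiener_paths"
  shows "exp_term (dir_deriv_adj I \<theta>) (\<lambda>_. 1) w sums exp (I \<theta> w - 1 / 2)"
proof -
  have "exp_term (dir_deriv_adj I \<theta>) (\<lambda>_. 1) w =
      (\<lambda>n. 1 ^ n / fact n * poly (hermite_rec n) (I \<theta> w))"
    using assms by (simp add: fun_eq_iff exp_term_def higher_dir_deriv_adj_1 hermite_eq_hermite_rec)
  then show ?thesis using hermite_rec_sums[of 1 "I \<theta> w"] by simp
qed

lemma op_exp_dir_deriv_adj_1:
  assumes "w \<in> wiener_paths"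
  shows "op_exp (dir_deriv_adj I \<theta>) (\<lambda>_. 1) w = exp (I \<theta> w - 1 / 2)"
  using exp_term_dir_deriv_adj_sums[OF assms] by (simp add: op_exp_def sums_iff)

lemma poly_wiener_integral_poly_functionals:
  assumes "h \<in> cameron_martin"
  shows "(\<lambda>w. poly q (I h w)) \<in> poly_functionals I"
proof -
  obtain p where "mpoly_in_vars 1 p" "\<And>x. mpoly_eval p x = poly q (x 0)"
    using univariate_mpoly by blast
  then show ?thesis
    using assms unfolding poly_functionals_def by (intro CollectI exI[of _ 1] exI[of _ "\<lambda>_. h"] exI[of _ p]) simp
qed

lemma op_exp_dir_deriv:
  assumes "F \<in> poly_functionals I" "w \<in> wiener_paths"
  shows "op_exp (dir_deriv \<theta>) F w = F (path_add w \<theta>)"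
proof -
  from assms(1) obtain n h p where h: "\<forall>i<n. h i \<in> cameron_martin" and p: "mpoly_in_vars n p"
    and F: "\<forall>w\<in>wiener_paths. F w = mpoly_eval p (\<lambda>i. I (h i) w)"
    unfolding poly_functionals_def by (elim CollectE exE conjE) (rule that)
  obtain q where q: "\<And>\<epsilon>. poly q \<epsilon> = mpoly_eval p (\<lambda>i. I (h i) w + \<epsilon> * cm_inner (h i) \<theta>)"
    by (rule mpoly_eval_line) (rule that)
  have "F (path_add w (path_scale \<epsilon> \<theta>)) = poly q \<epsilon>" for \<epsilon>
  proof -
    have "path_add w (path_scale \<epsilon> \<theta>) \<in> wiener_paths"
      using assms(2) direction_wiener_paths by (intro path_add_wiener_paths path_scale_wiener_paths)
    then have "F (path_add w (path_scale \<epsilon> \<theta>)) =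
        mpoly_eval p (\<lambda>i. I (h i) (path_add w (path_scale \<epsilon> \<theta>)))"
      by (rule F[rule_format])
    \<comment> \<open>The shift rule is known for \<open>h i\<close> with \<open>i < n\<close>, and
      these are the only variables that occur in \<open>p\<close>.\<close>
    also have "\<dots> = poly q \<epsilon>"
      unfolding q using h assms(2)
      by (intro mpoly_eval_cong[OF p]) (simp add: wiener_integral_shift_scale)
    finally show ?thesis .
  qed
  then show ?thesis
    using assms(2) direction_wiener_paths by (rule op_exp_dir_deriv_poly)
qed

text \<open>The shift law is part of the definition because an L^2 limit fixes \<open>X\<close> only
  up to null sets and so says nothing about its values at translated paths. For Wiener integrals the
  law comes from the convention, and linear combinations inherit it.\<close>

definition affine_functional :: "(real \<Rightarrow> real) \<Rightarrow> real \<Rightarrow> (path \<Rightarrow> real) \<Rightarrow> bool" where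
  "affine_functional f c L \<longleftrightarrow> (\<exists>X. wiener_limit \<gamma> f X \<and>
     (\<forall>w\<in>wiener_paths. X (path_add w \<theta>) = X w + (\<integral>t. f t * cm_density \<theta> t \<partial>lborel)) \<and>
     (\<forall>w\<in>wiener_paths. L w = X w + c))"

definition affine_functionals :: "(path \<Rightarrow> real) set" where
  "affine_functionals = {L. \<exists>f c. affine_functional f c L}"

lemma space_wiener [simp]: "space \<gamma> = wiener_paths"
  using wiener_measure by (simp add: wiener_measure_def)

lemma wiener_limit_wiener_integral:
  assumes "h \<in> cameron_martin"
  shows "wiener_limit \<gamma> (cm_density h) (I h)"
proof -
  have "wiener_limit \<gamma> (\<lambda>t. indicator {0..1} t * path_deriv h t) (I h)"
    using assms wiener_integral
    by (intro is_wiener_integral_of_imp_wiener_limit wiener_measure)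
       (auto simp: wiener_integral_def cameron_martin_def)
  then show ?thesis by (simp add: cm_density_def [abs_def])
qed

lemma cm_density_direction:
  "cm_density \<theta> \<in> borel_measurable lborel" "integrable lborel (\<lambda>t. (cm_density \<theta> t)\<^sup>2)"
  using wiener_limit_wiener_integral[OF direction] by (auto simp: wiener_limit_def)

lemma affine_functional_wiener_integral:
  assumes "h \<in> cameron_martin"
  shows "affine_functional (cm_density h) 0 (I h)"
  unfolding affine_functional_def using assms
  by (intro exI[of _ "I h"]) (simp add: wiener_limit_wiener_integral wiener_integral_shift cm_inner_eq)

lemma affine_functional_const: "affine_functional (\<lambda>_. 0) c (\<lambda>_. c)"
  unfolding affine_functional_def by (intro exI[of _ "\<lambda>_. 0"]) (simp add: wiener_limit_zero)

lemma affine_functional_measurable: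
  assumes "affine_functional f c L"
  shows "L \<in> borel_measurable (completion \<gamma>)"
proof -
  obtain X where X: "wiener_limit \<gamma> f X" and L: "\<And>w. w \<in> wiener_paths \<Longrightarrow> L w = X w + c"
    using assms unfolding affine_functional_def by blast
  have [measurable]: "X \<in> borel_measurable (completion \<gamma>)"
    using X by (simp add: wiener_limit_def)
  have "(\<lambda>w. X w + c) \<in> borel_measurable (completion \<gamma>)" by measurable
  then show ?thesis by (subst measurable_cong[where g = "\<lambda>w. X w + c"]) (simp_all add: L)
qed

lemma affine_functional_lincomb:
  assumes "affine_functional f c L" "affine_functional g d M"
  shows "affine_functional (\<lambda>t. f t + a * g t) (c + a * d) (\<lambda>w. L w + a * M w)"
proof -
  obtain X where X: "wiener_limit \<gamma> f X"
    "\<And>w. w \<in> wiener_paths \<Longrightarrow> X (path_add w \<theta>) = X w + (\<integral>t. f t * cm_density \<theta> t \<partial>lborel)"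
    "\<And>w. w \<in> wiener_paths \<Longrightarrow> L w = X w + c"
    using assms(1) unfolding affine_functional_def by blast
  obtain Y where Y: "wiener_limit \<gamma> g Y"
    "\<And>w. w \<in> wiener_paths \<Longrightarrow> Y (path_add w \<theta>) = Y w + (\<integral>t. g t * cm_density \<theta> t \<partial>lborel)"
    "\<And>w. w \<in> wiener_paths \<Longrightarrow> M w = Y w + d"
    using assms(2) unfolding affine_functional_def by blast
  have "integrable lborel (\<lambda>t. f t * cm_density \<theta> t)" "integrable lborel (\<lambda>t. g t * cm_density \<theta> t)"
    using X(1) Y(1) unfolding wiener_limit_def
    by (auto intro: integrable_square_mult cm_density_direction)
  then have "(\<integral>t. (f t + a * g t) * cm_density \<theta> t \<partial>lborel) =
      (\<integral>t. f t * cm_density \<theta> t \<partial>lborel) + a * (\<integral>t. g t * cm_density \<theta> t \<partial>lborel)"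
    by (simp add: distrib_right mult.assoc)
  moreover have "wiener_limit \<gamma> (\<lambda>t. f t + a * g t) (\<lambda>w. X w + a * Y w)"
    using wiener_limit_lincomb[OF wiener_measure X(1) Y(1), of 1 a] by simp
  ultimately show ?thesis
    unfolding affine_functional_def using X Y
    by (intro exI[of _ "\<lambda>w. X w + a * Y w"]) (simp add: algebra_simps)
qed

text \<open>The same \<open>X\<close> serves as witness and only the constant moves, so
  measurability of the translation of paths never enters.\<close>

lemma affine_functional_shift:
  assumes "affine_functional f c L"
  shows "affine_functional f (c + (\<integral>t. f t * cm_density \<theta> t \<partial>lborel)) (\<lambda>w. L (path_add w \<theta>))"
proof -
  obtain X where X: "wiener_limit \<gamma> f X"
    "\<forall>w\<in>wiener_paths. X (path_add w \<theta>) = X w + (\<integral>t. f t * cm_density \<theta> t \<partial>lborel)"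
    "\<forall>w\<in>wiener_paths. L w = X w + c"
    using assms unfolding affine_functional_def by blast
  then show ?thesis
    unfolding affine_functional_def
    by (intro exI[of _ X]) (simp add: path_add_wiener_paths direction_wiener_paths)
qed

lemma affine_functional_mgf:
  assumes "affine_functional f c L"
  shows "integrable (completion \<gamma>) (\<lambda>w. exp (L w))"
    and "(\<integral>w. exp (L w) \<partial>completion \<gamma>) = exp (c + (\<integral>t. (f t)\<^sup>2 \<partial>lborel) / 2)"
proof -
  obtain X where X: "wiener_limit \<gamma> f X" and L: "\<And>w. w \<in> wiener_paths \<Longrightarrow> L w = X w + c"
    using assms unfolding affine_functional_def by blast
  note mgf = wiener_limit_mgf[OF wiener_measure X]
  have "integrable (completion \<gamma>) (\<lambda>w. exp (L w)) \<longleftrightarrow> integrable (completion \<gamma>) (\<lambda>w. exp c * exp (X w))"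
    by (rule Bochner_Integration.integrable_cong) (simp_all add: L exp_add)
  then show "integrable (completion \<gamma>) (\<lambda>w. exp (L w))" using mgf(1) by simp
  have "(\<integral>w. exp (L w) \<partial>completion \<gamma>) = (\<integral>w. exp c * exp (X w) \<partial>completion \<gamma>)"
    by (rule Bochner_Integration.integral_cong) (simp_all add: L exp_add)
  then show "(\<integral>w. exp (L w) \<partial>completion \<gamma>) = exp (c + (\<integral>t. (f t)\<^sup>2 \<partial>lborel) / 2)"
    using mgf(2) by (simp add: exp_add)
qed

text \<open>The logarithm of the Cameron-Martin density for translation by \<theta>.\<close>

definition density_exponent :: "path \<Rightarrow> real" where
  "density_exponent w = I \<theta> w - 1 / 2"

lemma affine_functional_density_exponent:
  "affine_functional (cm_density \<theta>) (- 1 / 2) density_exponent"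
  using affine_functional_lincomb[OF affine_functional_wiener_integral[OF direction]
      affine_functional_const[of "- 1 / 2"], of 1]
  by (simp add: density_exponent_def [abs_def])

text \<open>Both sides are Gaussian moment generating functions, and completing the square turns the
  shift into the density.\<close>

lemma integral_exp_affine_shift:
  assumes L: "affine_functional f c L"
  shows "(\<integral>w. exp (L w + density_exponent w) \<partial>completion \<gamma>) =
    (\<integral>w. exp (L (path_add w \<theta>)) \<partial>completion \<gamma>)"
proof -
  let ?u = "cm_density \<theta>"
  have f: "f \<in> borel_measurable lborel" "integrable lborel (\<lambda>t. (f t)\<^sup>2)"
    using L unfolding affine_functional_def wiener_limit_def by auto
  have "(\<integral>t. ?u t * ?u t \<partial>lborel) = 1"
    using cm_inner_direction by (simp add: cm_inner_eq)
  \<comment> \<open>In the exponent of the moment generating function, half of the final 1 cancels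
    the constant -1/2, and half of the cross term is the amount by which translation moves the
    constant of \<open>L\<close>.\<close>
  then have "(\<integral>t. (f t + 1 * ?u t)\<^sup>2 \<partial>lborel) =
      (\<integral>t. (f t)\<^sup>2 \<partial>lborel) + 2 * (\<integral>t. f t * ?u t \<partial>lborel) + 1"
    using integrable_square_lincomb(2)[OF f(1) cm_density_direction(1) f(2) cm_density_direction(2), of 1 1]
    by (simp add: power2_eq_square)
  then show ?thesis
    using affine_functional_mgf(2)[OF affine_functional_lincomb[OF L affine_functional_density_exponent, of 1]]
      affine_functional_mgf(2)[OF affine_functional_shift[OF L]]
    by (simp add: algebra_simps add_divide_distrib)
qed

section \<open>Closure properties of affine functionals and their products\<close>

lemma affine_functionals_lincomb:
  assumes "L \<in> affine_functionals" "M \<in> affine_functionals"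
  shows "(\<lambda>w. L w + a * M w) \<in> affine_functionals"
  using assms affine_functional_lincomb unfolding affine_functionals_def by blast

lemma affine_functionals_shift:
  assumes "L \<in> affine_functionals"
  shows "(\<lambda>w. L (path_add w \<theta>)) \<in> affine_functionals"
  using assms affine_functional_shift unfolding affine_functionals_def by blast

lemma affine_functionals_const: "(\<lambda>_. c) \<in> affine_functionals"
  using affine_functional_const unfolding affine_functionals_def by blast

lemma density_exponent_affine_functionals: "density_exponent \<in> affine_functionals"
  using affine_functional_density_exponent unfolding affine_functionals_def by blast

lemma affine_functionals_measurable:
  "L \<in> affine_functionals \<Longrightarrow> L \<in> borel_measurable (completion \<gamma>)"
  using affine_functional_measurable unfolding affine_functionals_def by blast

lemma products_measurable:
  "G \<in> products affine_functionals \<Longrightarrow> G \<in> borel_measurable (completion \<gamma>)"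
  by (induction rule: products.induct) (auto intro!: borel_measurable_times intro: affine_functionals_measurable)

lemma products_shift:
  "G \<in> products affine_functionals \<Longrightarrow> (\<lambda>w. G (path_add w \<theta>)) \<in> products affine_functionals"
proof (induction rule: products.induct)
  case (mult M G)
  from products.mult[OF affine_functionals_shift[OF mult.hyps(1)] mult.IH] show ?case .
qed (rule products.one)

text \<open>\<open>exp |M|\<close> is at most \<open>exp M + exp (- M)\<close>, and either term is
  absorbed by passing from \<open>L\<close> to \<open>L + M\<close> or \<open>L - M\<close>, which
  are again affine.\<close>

lemma integrable_exp_abs_affine:
  assumes int: "\<And>L. L \<in> affine_functionals \<Longrightarrow> integrable (completion \<gamma>) (\<lambda>w. exp (L w) * \<bar>G w\<bar>)"
    and [measurable]: "G \<in> borel_measurable (completion \<gamma>)"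
    and LM: "L \<in> affine_functionals" "M \<in> affine_functionals"
  shows "integrable (completion \<gamma>) (\<lambda>w. exp (L w) * \<bar>G w\<bar> * exp \<bar>M w\<bar>)"
proof (rule Bochner_Integration.integrable_bound)
  note [measurable] = LM[THEN affine_functionals_measurable]
  show "integrable (completion \<gamma>) (\<lambda>w. exp (L w + 1 * M w) * \<bar>G w\<bar> + exp (L w + (- 1) * M w) * \<bar>G w\<bar>)"
    by (intro Bochner_Integration.integrable_add int affine_functionals_lincomb LM)
  show "(\<lambda>w. exp (L w) * \<bar>G w\<bar> * exp \<bar>M w\<bar>) \<in> borel_measurable (completion \<gamma>)"
    by measurable
  have "exp a * g * exp \<bar>b\<bar> \<le> exp (a + 1 * b) * g + exp (a + (- 1) * b) * g" if "g \<ge> 0" for a b g :: real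
    using that by (cases "b \<ge> 0") (auto simp: exp_add exp_diff exp_minus divide_inverse mult_ac)
  then show "AE w in completion \<gamma>. norm (exp (L w) * \<bar>G w\<bar> * exp \<bar>M w\<bar>) \<le>
      norm (exp (L w + 1 * M w) * \<bar>G w\<bar> + exp (L w + (- 1) * M w) * \<bar>G w\<bar>)"
    by (auto intro!: AE_I2)
qed

text \<open>A further factor is bounded by \<open>|M| \<le> exp |M|\<close> and moved into the
  exponent, which is why the induction must allow every \<open>L\<close>.\<close>

lemma integrable_exp_abs_products:
  assumes "G \<in> products affine_functionals" "L \<in> affine_functionals"
  shows "integrable (completion \<gamma>) (\<lambda>w. exp (L w) * \<bar>G w\<bar>)"
  using assms
proof (induction arbitrary: L rule: products.induct)
  case one
  then show ?case using affine_functional_mgf(1) by (auto simp: affine_functionals_def)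
next
  case (mult M G)
  note [measurable] = mult.hyps(1)[THEN affine_functionals_measurable]
    mult.prems[THEN affine_functionals_measurable] mult.hyps(2)[THEN products_measurable]
  show ?case
  proof (rule Bochner_Integration.integrable_bound)
    show "integrable (completion \<gamma>) (\<lambda>w. exp (L w) * \<bar>G w\<bar> * exp \<bar>M w\<bar>)"
      by (rule integrable_exp_abs_affine[OF mult.IH]) (use mult in \<open>auto intro: products_measurable\<close>)
    have "\<bar>b\<bar> \<le> exp \<bar>b\<bar>" for b :: real using exp_ge_add_one_self[of "\<bar>b\<bar>"] by linarith
    then show "AE w in completion \<gamma>. norm (exp (L w) * \<bar>M w * G w\<bar>) \<le>
        norm (exp (L w) * \<bar>G w\<bar> * exp \<bar>M w\<bar>)"
      by (auto intro!: AE_I2 mult_left_mono simp: abs_mult mult_ac)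
  qed measurable
qed

lemma integrable_exp_products:
  assumes "G \<in> products affine_functionals" "L \<in> affine_functionals"
  shows "integrable (completion \<gamma>) (\<lambda>w. exp (L w) * G w)"
proof -
  note [measurable] = products_measurable[OF assms(1)] affine_functionals_measurable[OF assms(2)]
  have "(\<lambda>w. exp (L w) * G w) \<in> borel_measurable (completion \<gamma>)" by measurable
  moreover have "integrable (completion \<gamma>) (\<lambda>w. norm (exp (L w) * G w))"
    using integrable_exp_abs_products[OF assms] by (simp add: abs_mult)
  ultimately show ?thesis using integrable_norm_iff by blast
qed

lemma tendsto_integral_exp_products:
  assumes G: "G \<in> products affine_functionals" and LM: "L \<in> affine_functionals" "M \<in> affine_functionals"
  shows "(\<lambda>n. ((\<integral>w. exp (L w + inverse (real (Suc n)) * M w) * G w \<partial>completion \<gamma>) -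
      (\<integral>w. exp (L w) * G w \<partial>completion \<gamma>)) / inverse (real (Suc n)))
    \<longlonglongrightarrow> (\<integral>w. exp (L w) * (M w * G w) \<partial>completion \<gamma>)"
proof -
  let ?N = "completion \<gamma>"
  note [measurable] = products_measurable[OF G] LM[THEN affine_functionals_measurable]
  define P where "P w = exp (L w) * G w" for w
  have eq: "exp (h * M w) * P w = exp (L w + h * M w) * G w" for h w
    by (simp add: P_def exp_add)
  have "(\<lambda>n. ((\<integral>w. exp (inverse (real (Suc n)) * M w) * P w \<partial>?N) - (\<integral>w. P w \<partial>?N)) /
      inverse (real (Suc n))) \<longlonglongrightarrow> (\<integral>w. M w * P w \<partial>?N)"
  proof (rule tendsto_integral_exp_diff_quotient)
    show "integrable ?N P"
      unfolding P_def by (rule integrable_exp_products[OF G LM(1)])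
    show "integrable ?N (\<lambda>w. exp (h * M w) * P w)" for h
      unfolding eq by (rule integrable_exp_products[OF G affine_functionals_lincomb[OF LM]])
    have MG: "(\<lambda>w. M w * G w) \<in> products affine_functionals"
      by (rule products.mult[OF LM(2) G])
    have "integrable ?N (\<lambda>w. exp (L w) * \<bar>M w * G w\<bar> * exp \<bar>M w\<bar>)"
      by (rule integrable_exp_abs_affine[OF integrable_exp_abs_products[OF MG] products_measurable[OF MG] LM])
    then show "integrable ?N (\<lambda>w. \<bar>M w * P w\<bar> * exp \<bar>M w\<bar>)"
      by (simp add: P_def abs_mult mult_ac)
  qed (unfold P_def, measurable)
  then show ?thesis unfolding eq by (simp add: P_def mult_ac)
qed

text \<open>Induction on the number of factors with \<open>L\<close> arbitrary: the hypothesis for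
  \<open>L + h M\<close> and for \<open>L\<close> makes the difference quotients of both sides one
  and the same sequence, whose limit on each side contains the new factor \<open>M\<close>.\<close>

lemma integral_exp_products_shift:
  assumes "G \<in> products affine_functionals" "L \<in> affine_functionals"
  shows "(\<integral>w. exp (L w + density_exponent w) * G w \<partial>completion \<gamma>) =
    (\<integral>w. exp (L (path_add w \<theta>)) * G (path_add w \<theta>) \<partial>completion \<gamma>)"
  using assms
proof (induction arbitrary: L rule: products.induct)
  case one
  then show ?case using integral_exp_affine_shift by (auto simp: affine_functionals_def)
next
  case (mult M G)
  let ?N = "completion \<gamma>"
  let ?h = "\<lambda>n. inverse (real (Suc n))"
  define K where "K w = L w + density_exponent w" for w
  have K: "K \<in> affine_functionals"
    using affine_functionals_lincomb[OF mult.prems density_exponent_affine_functionals, of 1]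
    by (simp add: K_def [abs_def])
  have "(\<integral>w. exp (K w + ?h n * M w) * G w \<partial>?N) =
      (\<integral>w. exp (L (path_add w \<theta>) + ?h n * M (path_add w \<theta>)) * G (path_add w \<theta>) \<partial>?N)" for n
    using mult.IH[OF affine_functionals_lincomb[OF mult.prems mult.hyps(1), of "?h n"]]
    by (simp add: K_def add_ac)
  moreover have "(\<integral>w. exp (K w) * G w \<partial>?N) = (\<integral>w. exp (L (path_add w \<theta>)) * G (path_add w \<theta>) \<partial>?N)"
    using mult.IH[OF mult.prems] by (simp add: K_def)
  ultimately show ?case
    using tendsto_integral_exp_products[OF mult.hyps(2) K mult.hyps(1)]
      tendsto_integral_exp_products[OF products_shift[OF mult.hyps(2)]
        affine_functionals_shift[OF mult.prems] affine_functionals_shift[OF mult.hyps(1)]]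
    unfolding K_def [symmetric] by (simp only:) (rule LIMSEQ_unique)
qed

section \<open>From products to polynomial functionals\<close>

lemma expectation_poly_functional_shift:
  assumes "F \<in> poly_functionals I"
  shows "integrable (completion \<gamma>) (\<lambda>w. F (path_add w \<theta>))"
    and "integrable (completion \<gamma>) (\<lambda>w. F w * exp (I \<theta> w - 1 / 2))"
    and "(\<integral>w. F (path_add w \<theta>) \<partial>completion \<gamma>) = (\<integral>w. F w * exp (I \<theta> w - 1 / 2) \<partial>completion \<gamma>)"
proof -
  let ?N = "completion \<gamma>"
  from assms obtain n h p where h: "\<forall>i<n. h i \<in> cameron_martin" and p: "mpoly_in_vars n p"
    and F: "\<forall>w\<in>wiener_paths. F w = mpoly_eval p (\<lambda>i. I (h i) w)"
    unfolding poly_functionals_def by (elim CollectE exE conjE) (rule that)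
  define G where "G m w = (\<Prod>i\<in>Poly_Mapping.keys m. I (h i) w ^ Poly_Mapping.lookup m i)" for m w
  have G: "G m \<in> products affine_functionals" if "m \<in> Poly_Mapping.keys p" for m
    unfolding G_def
  proof (rule products_prod_power)
    fix i assume "i \<in> Poly_Mapping.keys m"
    then have "i < n" using p that by (auto simp: mpoly_in_vars_def)
    then show "I (h i) \<in> affine_functionals"
      using h affine_functional_wiener_integral[of "h i"] by (auto simp: affine_functionals_def)
  qed simp
  have F_eq: "F w = (\<Sum>m\<in>Poly_Mapping.keys p. Poly_Mapping.lookup p m * G m w)" if "w \<in> wiener_paths" for w
    using F that by (simp add: mpoly_eval_def G_def)
  have zero: "(\<lambda>_. 0) \<in> affine_functionals" by (rule affine_functionals_const)
  have int1: "integrable ?N (\<lambda>w. G m (path_add w \<theta>))" if "m \<in> Poly_Mapping.keys p" for m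
    using integrable_exp_products[OF products_shift[OF G[OF that]] zero] by simp
  have int2: "integrable ?N (\<lambda>w. G m w * exp (I \<theta> w - 1 / 2))" if "m \<in> Poly_Mapping.keys p" for m
    using integrable_exp_products[OF G[OF that] density_exponent_affine_functionals]
    by (simp add: density_exponent_def mult_ac)
  have eq: "(\<integral>w. G m (path_add w \<theta>) \<partial>?N) = (\<integral>w. G m w * exp (I \<theta> w - 1 / 2) \<partial>?N)"
    if "m \<in> Poly_Mapping.keys p" for m
    using integral_exp_products_shift[OF G[OF that] zero]
    by (simp add: density_exponent_def mult_ac)
  have F1: "F (path_add w \<theta>) = (\<Sum>m\<in>Poly_Mapping.keys p. Poly_Mapping.lookup p m * G m (path_add w \<theta>))"
    if "w \<in> wiener_paths" for w
    using that by (intro F_eq path_add_wiener_paths direction_wiener_paths)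
  have F2: "F w * exp (I \<theta> w - 1 / 2) =
      (\<Sum>m\<in>Poly_Mapping.keys p. Poly_Mapping.lookup p m * (G m w * exp (I \<theta> w - 1 / 2)))"
    if "w \<in> wiener_paths" for w
    by (simp only: F_eq[OF that] sum_distrib_right mult.assoc)
  have int1': "integrable ?N (\<lambda>w. \<Sum>m\<in>Poly_Mapping.keys p. Poly_Mapping.lookup p m * G m (path_add w \<theta>))"
    by (intro Bochner_Integration.integrable_sum integrable_mult_right int1)
  have int2': "integrable ?N (\<lambda>w. \<Sum>m\<in>Poly_Mapping.keys p.
      Poly_Mapping.lookup p m * (G m w * exp (I \<theta> w - 1 / 2)))"
    by (intro Bochner_Integration.integrable_sum integrable_mult_right int2)
  show "integrable ?N (\<lambda>w. F (path_add w \<theta>))"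
    using int1' by (subst Bochner_Integration.integrable_cong[OF refl F1]) simp_all
  show "integrable ?N (\<lambda>w. F w * exp (I \<theta> w - 1 / 2))"
    using int2' by (subst Bochner_Integration.integrable_cong[OF refl F2]) simp_all
  have "(\<integral>w. F (path_add w \<theta>) \<partial>?N) =
      (\<integral>w. (\<Sum>m\<in>Poly_Mapping.keys p. Poly_Mapping.lookup p m * G m (path_add w \<theta>)) \<partial>?N)"
    by (rule Bochner_Integration.integral_cong) (simp_all add: F1)
  also have "\<dots> = (\<Sum>m\<in>Poly_Mapping.keys p. Poly_Mapping.lookup p m * (\<integral>w. G m (path_add w \<theta>) \<partial>?N))"
    using int1 by (subst Bochner_Integration.integral_sum) simp_all
  also have "\<dots> = (\<Sum>m\<in>Poly_Mapping.keys p. Poly_Mapping.lookup p m *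
      (\<integral>w. G m w * exp (I \<theta> w - 1 / 2) \<partial>?N))"
    by (simp add: eq)
  also have "\<dots> = (\<integral>w. (\<Sum>m\<in>Poly_Mapping.keys p.
      Poly_Mapping.lookup p m * (G m w * exp (I \<theta> w - 1 / 2))) \<partial>?N)"
    using int2 by (subst Bochner_Integration.integral_sum) simp_all
  also have "\<dots> = (\<integral>w. F w * exp (I \<theta> w - 1 / 2) \<partial>?N)"
    by (rule Bochner_Integration.integral_cong) (simp_all only: F2 space_completion space_wiener)
  finally show "(\<integral>w. F (path_add w \<theta>) \<partial>?N) = (\<integral>w. F w * exp (I \<theta> w - 1 / 2) \<partial>?N)" .
qed

lemma expect_op_exp:
  assumes "F \<in> poly_functionals I"
  shows "integrable (completion \<gamma>) (op_exp (dir_deriv \<theta>) F)"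
    and "integrable (completion \<gamma>) (\<lambda>w. F w * op_exp (dir_deriv_adj I \<theta>) (\<lambda>_. 1) w)"
    and "expect \<gamma> (op_exp (dir_deriv \<theta>) F) =
      expect \<gamma> (\<lambda>w. F w * op_exp (dir_deriv_adj I \<theta>) (\<lambda>_. 1) w)"
proof -
  note shift = expectation_poly_functional_shift[OF assms]
  have 1: "op_exp (dir_deriv \<theta>) F w = F (path_add w \<theta>)" if "w \<in> space (completion \<gamma>)" for w
    using op_exp_dir_deriv[OF assms] that by simp
  have 2: "F w * op_exp (dir_deriv_adj I \<theta>) (\<lambda>_. 1) w = F w * exp (I \<theta> w - 1 / 2)"
    if "w \<in> space (completion \<gamma>)" for w
    using op_exp_dir_deriv_adj_1 that by simp
  show "integrable (completion \<gamma>) (op_exp (dir_deriv \<theta>) F)"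
    by (rule iffD2[OF Bochner_Integration.integrable_cong[OF refl] shift(1)]) (rule 1)
  show "integrable (completion \<gamma>) (\<lambda>w. F w * op_exp (dir_deriv_adj I \<theta>) (\<lambda>_. 1) w)"
    by (rule iffD2[OF Bochner_Integration.integrable_cong[OF refl] shift(2)]) (rule 2)
  show "expect \<gamma> (op_exp (dir_deriv \<theta>) F) =
      expect \<gamma> (\<lambda>w. F w * op_exp (dir_deriv_adj I \<theta>) (\<lambda>_. 1) w)"
    unfolding expect_def
    using shift(3) by (simp only: 1 2 cong: Bochner_Integration.integral_cong)
qed

end

theorem theorem2p6:
  fixes \<gamma> :: "path measure" and I :: "path \<Rightarrow> path \<Rightarrow> real" and \<theta> :: path
  assumes "wiener_measure \<gamma>"
    and "wiener_integral \<gamma> I"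
    and "\<theta> \<in> cameron_martin"
    and "cm_norm \<theta> = 1"
  shows "(\<forall>n. (\<forall>w\<in>wiener_paths.
              (dir_deriv_adj I \<theta> ^^ n) (\<lambda>_. 1) w = poly (hermite n) (I \<theta> w)) \<and>
            (\<lambda>w. poly (hermite n) (I \<theta> w)) \<in> poly_functionals I) \<and>
         (\<forall>w\<in>wiener_paths.
            summable (exp_term (dir_deriv_adj I \<theta>) (\<lambda>_. 1) w) \<and>
            op_exp (dir_deriv_adj I \<theta>) (\<lambda>_. 1) w = exp (I \<theta> w - 1 / 2)) \<and>
         (\<forall>F\<in>poly_functionals I.
            integrable (completion \<gamma>) (op_exp (dir_deriv \<theta>) F) \<and>
            integrable (completion \<gamma>) (\<lambda>w. F w * op_exp (dir_deriv_adj I \<theta>) (\<lambda>_. 1) w) \<and>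
            expect \<gamma> (op_exp (dir_deriv \<theta>) F) =
              expect \<gamma> (\<lambda>w. F w * op_exp (dir_deriv_adj I \<theta>) (\<lambda>_. 1) w))"
proof -
  interpret cameron_martin_direction \<gamma> I \<theta>
    by (rule cameron_martin_direction.intro) (rule assms)+
  show ?thesis
  proof (intro conjI allI ballI)
    fix n and w :: path
    assume "w \<in> wiener_paths"
    then show "(dir_deriv_adj I \<theta> ^^ n) (\<lambda>_. 1) w = poly (hermite n) (I \<theta> w)"
      by (rule higher_dir_deriv_adj_1)
  next
    fix n
    show "(\<lambda>w. poly (hermite n) (I \<theta> w)) \<in> poly_functionals I"
      by (rule poly_wiener_integral_poly_functionals[OF direction])
  next
    fix w :: path
    assume w: "w \<in> wiener_paths"
    show "summable (exp_term (dir_deriv_adj I \<theta>) (\<lambda>_. 1) w)"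
      using exp_term_dir_deriv_adj_sums[OF w] by (rule sums_summable)
    show "op_exp (dir_deriv_adj I \<theta>) (\<lambda>_. 1) w = exp (I \<theta> w - 1 / 2)"
      by (rule op_exp_dir_deriv_adj_1[OF w])
  qed (rule expect_op_exp; assumption)+
qed

end
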